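(* Let $a,b,c,\mu\in\mathbb{C}$. In each identity below assume that the arguments of the three gamma functions in the numerator on the right-hand side have positive real parts, and that the lower (third) parameters of the hypergeometric functions in the two $w_j$'s occurring are not in $\mathbb{Z}_{\le0}$. (1) For $x\in(0,1)\cup(1,\infty)$: $$\int_{-\infty}^0(-y)^{a-\mu-1}w_4(y;a,b,c)(x-y)^{\mu-1}dy=\frac{\Gamma(a-\mu)\Gamma(a-c-\mu+1)\Gamma(b-a+1)}{\Gamma(a+b-c-\mu+1)\Gamma(1-\mu)}\,x^{a-1}w_5(x;a-\mu,b,c).$$ (2) For $x\in(-\infty,0)\cup(1,\infty)$: $$\int_0^1y^{a-\mu-1}w_6(y;a,b,c)|x-y|^{\mu-1}dy=\frac{\Gamma(a-c-\mu+1)\Gamma(a-\mu)\Gamma(c-a-b+1)}{\Gamma(a-b-\mu+1)\Gamma(1-\mu)}\,|x|^{a-1}w_3(x;a-\mu,b,c).$$ (3) For $x\in(0,1)\cup(1,\infty)$: $$\int_{-\infty}^0(-y)^{b-\mu-1}w_3(y;a,b,c)(x-y)^{\mu-1}dy=\frac{\Gamma(b-\mu)\Gamma(b-c-\mu+1)\Gamma(a-b+1)}{\Gamma(a+b-c-\mu+1)\Gamma(1-\mu)}\,x^{b-1}w_5(x;a,b-\mu,c).$$ (4) For $x\in(-\infty,0)\cup(1,\infty)$: $$\int_0^1y^{b-\mu-1}w_6(y;a,b,c)|x-y|^{\mu-1}dy=\frac{\Gamma(b-c-\mu+1)\Gamma(b-\mu)\Gamma(c-a-b+1)}{\Gamm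a(b-a-\mu+1)\Gamma(1-\mu)}\,|x|^{b-1}w_4(x;a,b-\mu,c).$$
   Context: Write $F(a,b;c;z)={}_2F_1(a,b;c;z)$ for the Gauss hypergeometric function (power series for $|z|<1$, analytically continued to $\mathbb{C}\setminus[1,\infty)$, with $c\notin\mathbb{Z}_{\le0}$). Define $w_3(x;a,b,c)=|x|^{-a}F(a,a-c+1;a-b+1;x^{-1})$ for $x\in(-\infty,0)\cup(1,\infty)$; $w_4(x;a,b,c)=|x|^{-b}F(b,b-c+1;b-a+1;x^{-1})$ for $x\in(-\infty,0)\cup(1,\infty)$; $w_5(x;a,b,c)=F(a,b;a+b-c+1;1-x)$ for $x\in(0,\infty)$; $w_6(x;a,b,c)=|1-x|^{c-a-b}F(c-a,c-b;c-a-b+1;1-x)$ for $x\in(0,1)\cup(1,\infty)$. Convention: $1/\Gamma$ is entire, with value $0$ at nonpositive integers. *)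

theory Defs
  imports "HOL-Analysis.Analysis"
begin

(* Two functions with the stated properties agree on the (connected) slit plane, so hyp2F1 a b c z
   does not depend on the choice made by SOME there. It is meant to be used only for z in the slit
   plane and c not a nonpositive integer. *)
definition hyp2F1 :: "complex \<Rightarrow> complex \<Rightarrow> complex \<Rightarrow> complex \<Rightarrow> complex" where
  "hyp2F1 a b c = (SOME g. g holomorphic_on (- complex_of_real ` {1..}) \<and>
     (\<forall>z\<in>ball 0 1. g z = eval_fps (fps_hypergeo [a, b] [c] 1) z))"

(* Powers of a positive real base are principal: complex_of_real t powr s = exp (s * ln t). *)

definition w3 :: "real \<Rightarrow> complex \<Rightarrow> complex \<Rightarrow> complex \<Rightarrow> complex" where
  "w3 x a b c = complex_of_real \<bar>x\<bar> powr (- a) *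
     hyp2F1 a (a - c + 1) (a - b + 1) (complex_of_real (inverse x))"

definition w4 :: "real \<Rightarrow> complex \<Rightarrow> complex \<Rightarrow> complex \<Rightarrow> complex" where
  "w4 x a b c = complex_of_real \<bar>x\<bar> powr (- b) *
     hyp2F1 b (b - c + 1) (b - a + 1) (complex_of_real (inverse x))"

definition w5 :: "real \<Rightarrow> complex \<Rightarrow> complex \<Rightarrow> complex \<Rightarrow> complex" where
  "w5 x a b c = hyp2F1 a b (a + b - c + 1) (complex_of_real (1 - x))"

definition w6 :: "real \<Rightarrow> complex \<Rightarrow> complex \<Rightarrow> complex \<Rightarrow> complex" where
  "w6 x a b c = complex_of_real \<bar>1 - x\<bar> powr (c - a - b) *
     hyp2F1 (c - a) (c - b) (c - a - b + 1) (complex_of_real (1 - x))"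

definition has_set_integral :: "(real \<Rightarrow> complex) \<Rightarrow> real set \<Rightarrow> complex \<Rightarrow> bool" where
  "has_set_integral f S v \<longleftrightarrow> set_integrable lborel S f \<and> set_lebesgue_integral lborel S f = v"

end

theory Submission
  imports Defs "HOL-Complex_Analysis.Complex_Analysis"
begin

text \<open>
  All four integrals are instances of one formula on the slit plane: for \<open>C = p + q - B\<close> not a
  nonpositive integer and \<open>Re p\<close>, \<open>Re q\<close>, \<open>Re (p + q - A - B)\<close> positive,
  the integral over \<open>(0,1)\<close> of
  \<open>t^(p-1) (1-t)^(q-1) F(A,B;q;1-t) (1-zt)^(-(p+q-A))\<close> is a gamma quotient times
  \<open>F(p,p+q-A-B;C;z)\<close>. Integrating \<open>F(A,B;q;1-t)\<close> term by term against the Beta kernel and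
  summing by Gauss's theorem gives the moments, and also the absolute convergence at \<open>t = 0\<close>
  without any asymptotics of \<open>F\<close>; expanding \<open>(1-zt)^(-r)\<close> then gives the
  formula for \<open>|z| < 1\<close>, and the integral is holomorphic in \<open>z\<close>.

  The same integral provides the analytic continuation of \<open>F(a,b;c;z)\<close> when
  \<open>Re a\<close> and \<open>Re b\<close> are positive; the general case follows because \<open>F(a,b;c;z)\<close> is a
  primitive of \<open>(ab/c) F(a+1,b+1;c+1;z)\<close>.

  The integrals over \<open>(0,1)\<close> are this formula at \<open>z = 1/x\<close>. Those over the negative axis reduce to
  it at \<open>z = 1 - 1/x\<close> by \<open>y = -s/(1-s)\<close> and Pfaff's transformation of both \<open>F\<close>'s.
\<close>

subsection \<open>Parameter integrals and the complex Beta integral\<close>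

text \<open>Cauchy's inequality on circles of radius r/3, which stay inside the ball because r/2 +
  r/3 < r, bounds the derivative by 3B/r on the convex half-size ball. This turns a bound on f into
  a bound on its difference quotients.\<close>

lemma holomorphic_difference_bound:
  assumes hol: "f holomorphic_on ball z0 r"
    and bound: "\<And>z. z \<in> ball z0 r \<Longrightarrow> norm (f z) \<le> B"
    and z: "z \<in> ball z0 (r/2)"
  shows "norm (f z - f z0) \<le> 3 * B / r * norm (z - z0)"
proof (rule field_differentiable_bound[where f' = "deriv f"])
  have r: "r > 0" using z zero_le_dist[of z0 z] unfolding mem_ball by linarith
  show "convex (ball z0 (r/2))" by simp
  show "z \<in> ball z0 (r/2)" "z0 \<in> ball z0 (r/2)" using z r by auto
  fix w assume w: "w \<in> ball z0 (r/2)"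
  have sub: "cball w (r/3) \<subseteq> ball z0 r"
  proof
    fix u assume "u \<in> cball w (r/3)"
    then show "u \<in> ball z0 r" using w r dist_triangle[of z0 u w] by auto
  qed
  have "w \<in> ball z0 r" using w r by auto
  then show "(f has_field_derivative deriv f w) (at w within ball z0 (r/2))"
    using holomorphic_derivI[OF hol] by auto
  have "norm ((deriv ^^ 1) f w) \<le> fact 1 * B / (r/3) ^ 1"
  proof (rule Cauchy_inequality)
    show "f holomorphic_on ball w (r/3)"
      using hol sub by (meson ball_subset_cball holomorphic_on_subset order_trans)
    show "continuous_on (cball w (r/3)) f"
      using hol sub by (meson holomorphic_on_imp_continuous_on holomorphic_on_subset)
    show "0 < r/3" using r by simp
    fix x assume "norm (w - x) = r/3"
    then show "norm (f x) \<le> B" by (intro bound subsetD[OF sub]) (auto simp: dist_norm)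
  qed
  then show "norm (deriv f w) \<le> 3 * B / r" by (simp add: mult.commute)
qed

text \<open>Differentiation under the integral sign from a local integrable majorant of the
  integrand alone: Cauchy's estimate converts the majorant g into the majorant 3g/r of the
  difference quotients, so dominated convergence applies.\<close>

lemma holomorphic_on_set_lebesgue_integral:
  fixes f :: "complex \<Rightarrow> 'a \<Rightarrow> complex"
  assumes U: "open U"
    and meas: "\<And>z. z \<in> U \<Longrightarrow> set_borel_measurable M S (f z)"
    and hol: "\<And>t. t \<in> S \<Longrightarrow> (\<lambda>z. f z t) holomorphic_on U"
    and bound: "\<And>z0. z0 \<in> U \<Longrightarrow> \<exists>r>0. \<exists>g. ball z0 r \<subseteq> U \<and> set_integrable M S g \<and>
                   (\<forall>z\<in>ball z0 r. \<forall>t\<in>S. norm (f z t) \<le> g t)"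
  shows "(\<lambda>z. set_lebesgue_integral M S (f z)) holomorphic_on U"
proof -
  define F where "F z t = indicator S t *\<^sub>R f z t" for z t
  have F_meas: "F z \<in> borel_measurable M" if "z \<in> U" for z
    using meas[OF that] by (simp add: F_def[abs_def] set_borel_measurable_def)
  have F_hol: "(\<lambda>z. F z t) holomorphic_on U" for t
    using hol[of t] by (cases "t \<in> S") (auto simp: F_def)
  have "(\<lambda>z. integral\<^sup>L M (F z)) field_differentiable (at z0)" if z0: "z0 \<in> U" for z0
  proof -
    obtain r g where r: "r > 0" "ball z0 r \<subseteq> U" and g: "set_integrable M S g"
      and fg: "\<And>z t. z \<in> ball z0 r \<Longrightarrow> t \<in> S \<Longrightarrow> norm (f z t) \<le> g t"
      using bound[OF z0] by blast
    define G where "G t = indicator S t *\<^sub>R g t" for t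
    have G: "integrable M G" using g by (simp add: G_def[abs_def] set_integrable_def)
    have FG: "norm (F z t) \<le> G t" if "z \<in> ball z0 r" for z t
      using fg[OF that, of t] by (cases "t \<in> S") (auto simp: F_def G_def)
    have F_int: "integrable M (F z)" if "z \<in> ball z0 r" for z
      using that r FG[OF that]
      by (intro Bochner_Integration.integrable_bound[OF G F_meas]) (auto intro: order_trans[OF _ abs_ge_self])
    define D where "D t = deriv (\<lambda>z. F z t) z0" for t
    have D: "((\<lambda>z. F z t) has_field_derivative D t) (at z0)" for t
      unfolding D_def using holomorphic_derivI[OF F_hol U z0] .
    have at_eq: "at z0 = at z0 within ball z0 (r/2)"
      using r by (intro at_within_open[symmetric]) auto
    have lim: "((\<lambda>z. (F z t - F z0 t) / (z - z0)) \<longlongrightarrow> D t) (at z0 within ball z0 (r/2))" for t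
      using D[of t] unfolding at_eq[symmetric] by (simp add: has_field_derivative_iff)
    have "((\<lambda>z. (integral\<^sup>L M (F z) - integral\<^sup>L M (F z0)) / (z - z0)) \<longlongrightarrow> integral\<^sup>L M D)
            (at z0 within ball z0 (r/2))"
      \<comment> \<open>Dominated convergence speaks about sequences, so the limit of the difference
        quotients is tested along every sequence tending to \<open>z0\<close>.\<close>
      unfolding tendsto_at_iff_sequentially
    proof (intro allI impI)
      fix X assume X: "\<forall>i. X i \<in> ball z0 (r/2) - {z0}" "X \<longlonglongrightarrow> z0"
      define Q where "Q i t = (F (X i) t - F z0 t) / (X i - z0)" for i t
      have XU: "X i \<in> ball z0 r" for i
        using X(1)[rule_format, of i] r by auto
      have Q_lim: "(\<lambda>i. Q i t) \<longlonglongrightarrow> D t" for t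
        using lim[of t, unfolded tendsto_at_iff_sequentially] X unfolding Q_def comp_def by blast
      have Q_meas: "Q i \<in> borel_measurable M" for i
        unfolding Q_def[abs_def] using F_meas XU r z0
        by (intro borel_measurable_divide borel_measurable_diff F_meas) auto
      have "(\<lambda>i. integral\<^sup>L M (Q i)) \<longlonglongrightarrow> integral\<^sup>L M D"
      proof (rule integral_dominated_convergence[where w = "\<lambda>t. 3 * G t / r"])
        show "D \<in> borel_measurable M"
          using borel_measurable_LIMSEQ_metric[OF Q_meas Q_lim] by simp
        show "Q i \<in> borel_measurable M" for i by (rule Q_meas)
        show "integrable M (\<lambda>t. 3 * G t / r)" using G by simp
        show "AE t in M. (\<lambda>i. Q i t) \<longlonglongrightarrow> D t" using Q_lim by simp
        show "AE t in M. norm (Q i t) \<le> 3 * G t / r" for i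
        proof (rule AE_I2)
          fix t
          have ne: "norm (X i - z0) > 0" using X(1) by auto
          have "norm (F (X i) t - F z0 t) \<le> 3 * G t / r * norm (X i - z0)"
            using X(1) r by (intro holomorphic_difference_bound FG holomorphic_on_subset[OF F_hol]) auto
          then show "norm (Q i t) \<le> 3 * G t / r"
            using ne by (simp add: Q_def norm_divide divide_le_eq)
        qed
      qed
      moreover have "integral\<^sup>L M (Q i) = (integral\<^sup>L M (F (X i)) - integral\<^sup>L M (F z0)) / (X i - z0)" for i
        unfolding Q_def using F_int[OF XU] F_int[of z0] r by simp
      ultimately show "((\<lambda>z. (integral\<^sup>L M (F z) - integral\<^sup>L M (F z0)) / (z - z0)) \<circ> X)
                         \<longlonglongrightarrow> integral\<^sup>L M D"
        by (simp add: comp_def)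
    qed
    then show ?thesis
      unfolding at_eq[symmetric] field_differentiable_def has_field_derivative_iff by blast
  qed
  then show ?thesis
    unfolding set_lebesgue_integral_def F_def[symmetric]
    by (auto simp: holomorphic_on_def intro: field_differentiable_at_within)
qed

lemma norm_of_real_powr: "x \<ge> 0 \<Longrightarrow> norm (complex_of_real x powr s) = x powr Re s"
  by (subst norm_powr_real_powr) auto

lemma set_borel_measurable_lborel_continuous:
  fixes f :: "real \<Rightarrow> complex"
  assumes "continuous_on S f" "S \<in> sets borel"
  shows "set_borel_measurable lborel S f"
  using borel_measurable_continuous_on_indicator[OF assms(2,1)]
  by (simp add: set_borel_measurable_def)

section \<open>The Beta integral, first for real and then for complex parameters\<close>

lemma
  fixes a b :: real
  assumes "a > 0" "b > 0"
  shows set_integrable_Beta_real: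
          "set_integrable lborel {0<..<1} (\<lambda>t. t powr (a - 1) * (1 - t) powr (b - 1))"
    and set_lebesgue_integral_Beta_real:
          "(LINT t:{0<..<1}|lborel. t powr (a - 1) * (1 - t) powr (b - 1)) = Beta a b"
proof -
  show *: "set_integrable lborel {0<..<1} (\<lambda>t. t powr (a - 1) * (1 - t) powr (b - 1))"
    by (rule set_integrable_subset[OF integrable_Beta[OF assms]]) auto
  have "((\<lambda>t. t powr (a - 1) * (1 - t) powr (b - 1)) has_integral Beta a b) {0<..<1}"
    using has_integral_Beta_real[OF assms] by (simp add: has_integral_Icc_iff_Ioo)
  then show "(LINT t:{0<..<1}|lborel. t powr (a - 1) * (1 - t) powr (b - 1)) = Beta a b"
    using set_borel_integral_eq_integral(2)[OF *] by (simp add: integral_unique)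
qed

lemma continuous_on_of_real_powr:
  fixes g :: "real \<Rightarrow> real" and s :: complex
  assumes "continuous_on S g" "\<And>t. t \<in> S \<Longrightarrow> g t > 0"
  shows "continuous_on S (\<lambda>t. complex_of_real (g t) powr s)"
proof -
  have eq: "complex_of_real (g t) powr s = exp (s * complex_of_real (ln (g t)))" if "t \<in> S" for t
    using assms(2)[OF that] by (simp add: powr_def Ln_of_real)
  have "\<forall>t\<in>S. g t \<noteq> 0" using assms(2) by fastforce
  then have "continuous_on S (\<lambda>t. exp (s * complex_of_real (ln (g t))))"
    using assms(1) by (intro continuous_intros)
  then show ?thesis
    using eq by (subst continuous_on_cong[OF refl]) auto
qed

lemma set_integrable_Beta_complex:
  fixes a b :: complex
  assumes "Re a > 0" "Re b > 0"
  shows "set_integrable lborel {0<..<1} (\<lambda>t. of_real t powr (a - 1) * of_real (1 - t) powr (b - 1))"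
proof -
  have meas: "set_borel_measurable lborel {0<..<1} (\<lambda>t. of_real t powr (a - 1) * of_real (1 - t) powr (b - 1))"
    by (intro set_borel_measurable_lborel_continuous continuous_on_mult continuous_on_of_real_powr
        continuous_intros) auto
  show ?thesis
  proof (rule set_integrable_bound[OF set_integrable_Beta_real[OF assms] meas])
    show "AE t in lborel. t \<in> {0<..<1} \<longrightarrow>
            norm (complex_of_real t powr (a - 1) * of_real (1 - t) powr (b - 1)) \<le>
            norm (t powr (Re a - 1) * (1 - t) powr (Re b - 1))"
      unfolding norm_mult by (intro AE_I2 impI, subst (1 2) norm_of_real_powr) auto
  qed
qed

lemma Re_pos_not_nonpos_Ints: "Re z > 0 \<Longrightarrow> z \<notin> \<int>\<^sub>\<le>\<^sub>0"
  by (auto elim!: nonpos_Ints_cases)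

text \<open>The identity theorem on the connected right half-plane: the positive reals accumulate at
  its interior point 1.\<close>

lemma holomorphic_eq_of_eq_on_positive_reals:
  assumes "f holomorphic_on {z. Re z > 0}" "g holomorphic_on {z. Re z > 0}"
    and "\<And>x. x > 0 \<Longrightarrow> f (of_real x) = g (of_real x)" and z: "Re z > 0"
  shows "f z = g z"
proof -
  have "f z - g z = 0"
  proof (rule analytic_continuation[where f = "\<lambda>z. f z - g z" and w = z and S = "{z. Re z > 0}" and U = "of_real ` {0<..}" and \<xi> = 1])
    show "(\<lambda>z. f z - g z) holomorphic_on {z. Re z > 0}"
      using assms by (intro holomorphic_intros)
    show "open {z. Re z > 0}" by (rule open_halfspace_Re_gt)
    show "connected {z. Re z > 0}" by (rule convex_connected[OF convex_halfspace_Re_gt])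
    have "(1::real) islimpt {0<..}" by (simp add: open_imp_islimpt islimpt_UNIV interior_limit_point)
    then obtain X where X: "\<And>n. X n \<in> {0<..} - {1::real}" "X \<longlonglongrightarrow> 1"
      unfolding islimpt_sequential by blast
    have "of_real (X n) \<in> complex_of_real ` {0<..} - {1}" for n
      using X(1)[of n] by auto
    moreover have "(\<lambda>n. complex_of_real (X n)) \<longlonglongrightarrow> 1"
      using tendsto_of_real[OF X(2)] by simp
    ultimately show "1 islimpt complex_of_real ` {0<..}"
      unfolding islimpt_sequential by (intro exI[of _ "\<lambda>n. complex_of_real (X n)"]) simp
  qed (use assms in auto)
  then show ?thesis by simp
qed

text \<open>Near \<open>a0\<close> one has Re a >= Re a0 / 2, and for 0 < t < 1 a smaller exponent
  gives a larger power. Hence one real Beta integrand with exponent Re a0 / 2 - 1 dominates on the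
  whole neighbourhood.\<close>

lemma holomorphic_Beta_integral:
  assumes b: "Re b > 0"
  shows "(\<lambda>a. LINT t:{0<..<1}|lborel. of_real t powr (a - 1) * of_real (1 - t) powr (b - 1))
           holomorphic_on {a. Re a > 0}"
proof (rule holomorphic_on_set_lebesgue_integral)
  show "open {a. Re a > 0}" by (rule open_halfspace_Re_gt)
  show "set_borel_measurable lborel {0<..<1} (\<lambda>t. of_real t powr (a - 1) * of_real (1 - t) powr (b - 1))" for a
    by (intro set_borel_measurable_lborel_continuous continuous_on_mult continuous_on_of_real_powr
        continuous_intros) auto
  show "(\<lambda>a. of_real t powr (a - 1) * of_real (1 - t) powr (b - 1)) holomorphic_on {a. Re a > 0}"
    if "t \<in> {0<..<1}" for t
    using that by (intro holomorphic_intros) auto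
  fix a0 assume "a0 \<in> {a. Re a > 0}"
  then have a0: "Re a0 > 0" by simp
  have Re_near: "Re a0 / 2 \<le> Re a" if "a \<in> ball a0 (Re a0 / 2)" for a
    using that abs_Re_le_cmod[of "a0 - a"] by (auto simp: dist_norm)
  show "\<exists>r>0. \<exists>g. ball a0 r \<subseteq> {a. Re a > 0} \<and> set_integrable lborel {0<..<1} g \<and>
     (\<forall>a\<in>ball a0 r. \<forall>t\<in>{0<..<1}. norm (of_real t powr (a - 1) * of_real (1 - t) powr (b - 1)) \<le> g t)"
  proof (intro exI conjI ballI)
    show "Re a0 / 2 > 0" using a0 by simp
    show "ball a0 (Re a0 / 2) \<subseteq> {a. Re a > 0}" using Re_near a0 by fastforce
    show "set_integrable lborel {0<..<1} (\<lambda>t. t powr (Re a0 / 2 - 1) * (1 - t) powr (Re b - 1))"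
      using a0 b by (intro set_integrable_Beta_real) auto
    fix a t assume a: "a \<in> ball a0 (Re a0 / 2)" and t: "t \<in> {0<..<(1::real)}"
    have "t powr (Re a - 1) \<le> t powr (Re a0 / 2 - 1)"
      using t Re_near[OF a] by (intro powr_mono') auto
    then show "norm (of_real t powr (a - 1) * of_real (1 - t) powr (b - 1)) \<le>
                 t powr (Re a0 / 2 - 1) * (1 - t) powr (Re b - 1)"
      unfolding norm_mult using t by (subst (1 2) norm_of_real_powr) (auto intro!: mult_right_mono)
  qed
qed

lemma Beta_integral_swap:
  "(LINT t:{0<..<1}|lborel. complex_of_real t powr (a - 1) * of_real (1 - t) powr (b - 1)) =
   (LINT t:{0<..<1}|lborel. complex_of_real t powr (b - 1) * of_real (1 - t) powr (a - 1))"
proof -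
  have "indicator {0<..<1} (1 - t) = (indicator {0<..<1} t :: real)" for t :: real
    by (auto simp: indicator_def)
  then show ?thesis
    unfolding set_lebesgue_integral_def
    by (subst lborel_integral_real_affine[where c = "-1" and t = 1]) (simp_all add: mult.commute)
qed

text \<open>The real case is extended one argument at a time by the identity theorem: first to
  complex a with b real, then, after swapping the arguments, to complex b. Thus holomorphy is only
  ever needed in the first argument.\<close>

theorem set_lebesgue_integral_Beta_complex:
  assumes a: "Re a > 0" and b: "Re b > 0"
  shows "(LINT t:{0<..<1}|lborel. of_real t powr (a - 1) * of_real (1 - t) powr (b - 1)) = Beta a b"
proof -
  let ?I = "\<lambda>a b. LINT t:{0<..<1}|lborel. complex_of_real t powr (a - 1) * of_real (1 - t) powr (b - 1)"
  have hol: "(\<lambda>a. Beta a b) holomorphic_on {a. Re a > 0}" if "Re b > 0" for b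
    unfolding Beta_altdef using Re_pos_not_nonpos_Ints that by (intro holomorphic_intros) auto
  have real: "?I (of_real x) (of_real y) = Beta (of_real x) (of_real y)" if "x > 0" "y > 0" for x y
  proof -
    have "?I (of_real x) (of_real y) =
           (LINT t:{0<..<1}|lborel. complex_of_real (t powr (x - 1) * (1 - t) powr (y - 1)))"
      by (intro set_lebesgue_integral_cong) (auto simp: powr_of_real[symmetric])
    also have "\<dots> = of_real (Beta x y)"
      using set_lebesgue_integral_Beta_real[OF that]
      by (simp only: set_integral_complex_of_real)
    finally show ?thesis by (simp add: Beta_complex_of_real)
  qed
  have "?I a (of_real y) = Beta a (of_real y)" if "y > 0" for y
    using that
    by (intro holomorphic_eq_of_eq_on_positive_reals[OF holomorphic_Beta_integral hol real a]) auto
  then have "?I (of_real y) a = Beta (of_real y) a" if "y > 0" for y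
    using that Beta_integral_swap[of "of_real y" a] Beta_commute[of a "of_real y"] by metis
  then have "?I b a = Beta b a"
    by (intro holomorphic_eq_of_eq_on_positive_reals[OF holomorphic_Beta_integral[OF a] hol[OF a] _ b])
  then show ?thesis using Beta_integral_swap[of a b] Beta_commute[of a b] by metis
qed

subsection \<open>Gauss's summation theorem\<close>

definition hyp_coeff :: "complex \<Rightarrow> complex \<Rightarrow> complex \<Rightarrow> nat \<Rightarrow> complex" where
  "hyp_coeff a b c n = pochhammer a n * pochhammer b n / (pochhammer c n * fact n)"

lemma fps_nth_hypergeo_2_1: "fps_nth (fps_hypergeo [a, b] [c] 1) n = hyp_coeff a b c n"
  by (simp add: hyp_coeff_def)

lemma hyp_coeff_0 [simp]: "hyp_coeff a b c 0 = 1"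
  by (simp add: hyp_coeff_def)

lemma hyp_coeff_Suc:
  "hyp_coeff a b c (Suc n) =
     hyp_coeff a b c n * ((a + of_nat n) * (b + of_nat n) / ((c + of_nat n) * of_nat (Suc n)))"
  by (simp add: hyp_coeff_def pochhammer_Suc mult_ac del: of_nat_Suc)

text \<open>Each Pochhammer symbol is a term of \<open>rGamma_series\<close> times n! n^z. So the
  coefficient is a convergent, hence bounded, quotient times n^(a+b-c) / (n+1). The index is
  \<open>Suc n\<close> because \<open>rGamma_series z n\<close> is built from
  \<open>pochhammer z (Suc n)\<close>.\<close>

lemma hyp_coeff_bound:
  assumes c: "c \<notin> \<int>\<^sub>\<le>\<^sub>0"
  obtains K where "K > 0"
    "\<And>n. n > 0 \<Longrightarrow> norm (hyp_coeff a b c (Suc n)) \<le> K * real n powr (Re (a + b - c) - 1)"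
proof -
  define r where "r n = rGamma_series a n * rGamma_series b n / rGamma_series c n" for n
  have "r \<longlonglongrightarrow> rGamma a * rGamma b / rGamma c"
    unfolding r_def using c by (intro tendsto_intros) (auto simp: rGamma_eq_zero_iff)
  then have "Bseq r" by (intro convergent_imp_Bseq convergentI)
  then obtain K where K: "K > 0" "\<And>n. norm (r n) \<le> K" by (auto elim: BseqE)
  have "norm (hyp_coeff a b c (Suc n)) \<le> K * real n powr (Re (a + b - c) - 1)" if n: "n > 0" for n
  proof -
    let ?e = "\<lambda>z::complex. exp (z * of_real (ln (real n)))"
    have poch: "pochhammer z (Suc n) = rGamma_series z n * (fact n * ?e z)" for z
      by (simp add: rGamma_series_def)
    have e: "?e a * ?e b / ?e c = ?e (a + b - c)"
      by (simp add: exp_add exp_diff ring_distribs)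
    have "pochhammer c (Suc n) \<noteq> 0"
      using c by (metis pochhammer_eq_0_imp_nonpos_Int)
    then have "rGamma_series c n \<noteq> 0" unfolding poch by auto
    then have "hyp_coeff a b c (Suc n) = r n * (?e a * ?e b / ?e c) / of_nat (Suc n)"
      unfolding hyp_coeff_def poch r_def by (simp add: field_simps del: of_nat_Suc)
    then have "norm (hyp_coeff a b c (Suc n)) = norm (r n) * norm (?e (a + b - c)) / real (Suc n)"
      unfolding e by (simp add: norm_mult norm_divide del: of_nat_Suc)
    also have "norm (?e (a + b - c)) = real n powr (Re (a + b - c))"
      using n by (simp add: powr_def mult.commute)
    also have "norm (r n) * real n powr (Re (a + b - c)) / real (Suc n) \<le>
                 K * real n powr (Re (a + b - c)) / real n"
      using K n by (intro frac_le mult_right_mono) auto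
    also have "\<dots> = K * real n powr (Re (a + b - c) - 1)"
      using n by (simp add: powr_diff)
    finally show ?thesis .
  qed
  with K(1) show ?thesis using that by blast
qed

lemma summable_norm_hyp_coeff:
  assumes c: "c \<notin> \<int>\<^sub>\<le>\<^sub>0" and "Re (c - a - b) > 0"
  shows "summable (\<lambda>n. norm (hyp_coeff a b c n))"
proof -
  obtain K where K: "\<And>n. n > 0 \<Longrightarrow> norm (hyp_coeff a b c (Suc n)) \<le> K * real n powr (Re (a + b - c) - 1)"
    using hyp_coeff_bound[OF c] by metis
  have "summable (\<lambda>n. norm (hyp_coeff a b c (Suc n)))"
  proof (rule summable_comparison_test_ev)
    show "\<forall>\<^sub>F n in sequentially. norm (norm (hyp_coeff a b c (Suc n))) \<le> K * real n powr (Re (a + b - c) - 1)"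
      using eventually_gt_at_top[of 0] by eventually_elim (use K in simp)
    show "summable (\<lambda>n. K * real n powr (Re (a + b - c) - 1))"
      using assms by (intro summable_mult) (simp add: summable_real_powr_iff)
  qed
  then show ?thesis by (subst (asm) summable_Suc_iff)
qed

text \<open>This makes the boundary term vanish when the relation of \<open>Gauss_step\<close>
  telescopes. With d = Re (c - a - b) the coefficients are O(n^(-1-d)), so one factor n still leaves
  the decay n^(-d).\<close>

lemma of_nat_times_hyp_coeff_tendsto_0:
  assumes c: "c \<notin> \<int>\<^sub>\<le>\<^sub>0" and "Re (c - a - b) > 0"
  shows "(\<lambda>n. of_nat n * hyp_coeff a b c n) \<longlonglongrightarrow> 0"
proof -
  define d where "d = Re (c - a - b)"
  have d: "d > 0" using assms by (simp add: d_def)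
  obtain K where K: "K > 0" "\<And>n. n > 0 \<Longrightarrow> norm (hyp_coeff a b c (Suc n)) \<le> K * real n powr (Re (a + b - c) - 1)"
    using hyp_coeff_bound[OF c] by metis
  have "(\<lambda>n. of_nat (Suc n) * hyp_coeff a b c (Suc n)) \<longlonglongrightarrow> 0"
  proof (rule Lim_null_comparison)
    show "\<forall>\<^sub>F n in sequentially. norm (of_nat (Suc n) * hyp_coeff a b c (Suc n)) \<le> 2 * K * real n powr (- d)"
      using eventually_gt_at_top[of 0]
    proof eventually_elim
      case (elim n)
      have "norm (of_nat (Suc n) * hyp_coeff a b c (Suc n)) \<le> real (Suc n) * (K * real n powr (- d - 1))"
        unfolding norm_mult norm_of_nat using K(2)[OF elim]
        by (intro mult_left_mono) (auto simp: d_def algebra_simps)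
      also have "\<dots> \<le> (2 * real n) * (K * real n powr (- d - 1))"
        using elim K(1) by (intro mult_right_mono) auto
      also have "\<dots> = 2 * K * real n powr (- d)"
        using elim by (simp add: powr_diff)
      finally show ?case .
    qed
    have "(\<lambda>n. real n powr (- d)) \<longlonglongrightarrow> 0"
      using d by (intro tendsto_neg_powr filterlim_real_sequentially) auto
    then show "(\<lambda>n. 2 * K * real n powr (- d)) \<longlonglongrightarrow> 0"
      by (rule tendsto_mult_right_zero)
  qed
  then show ?thesis by (rule LIMSEQ_imp_Suc)
qed

text \<open>Every factor c + k has positive real part, so moving it to the right increases its
  modulus. This supplies the domination for Tannery's theorem in
  \<open>Gauss_summation\<close>.\<close>

lemma norm_pochhammer_mono:
  assumes "Re c > 0"
  shows "norm (pochhammer c n) \<le> norm (pochhammer (c + of_nat m) n)"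
proof (induction n)
  case (Suc n)
  have "norm (c + of_nat n) \<le> norm (c + of_nat m + of_nat n)"
    unfolding cmod_def using assms
    by (intro real_sqrt_le_mono add_mono[of "(Re _)\<^sup>2"] power_mono[of "Re _"]) auto
  with Suc show ?case by (simp add: pochhammer_Suc norm_mult mult_mono)
qed simp

text \<open>Each coefficient of positive index contains a factor 1 / (c + m + k), which tends to 0
  as m grows, while the rest of its recursion stays fixed or convergent.\<close>

lemma hyp_coeff_shift_tendsto:
  "(\<lambda>m. hyp_coeff a b (c + of_nat m) n) \<longlonglongrightarrow> (if n = 0 then 1 else 0)"
proof (induction n)
  case (Suc n)
  have *: "filterlim (\<lambda>m. (c + of_nat n) + of_nat m) at_infinity sequentially"
    by (intro tendsto_add_filterlim_at_infinity[OF tendsto_const] tendsto_of_nat)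
  have "(\<lambda>m. (a + of_nat n) * (b + of_nat n) / of_nat (Suc n) / ((c + of_nat n) + of_nat m)) \<longlonglongrightarrow> 0"
    by (intro tendsto_divide_0[OF tendsto_const *])
  from tendsto_mult[OF Suc this] show ?case
    by (simp add: hyp_coeff_Suc field_simps del: of_nat_Suc)
qed simp

text \<open>The contiguous relation at z = 1 that raises c by one. Iterated, it pushes c to
  infinity, where the sum of the series is known to be 1.\<close>

lemma Gauss_step:
  assumes c: "Re c > 0" and d: "Re (c - a - b) > 0"
  shows "(\<Sum>n. hyp_coeff a b c n) * ((c - a - b) * c) =
         (c - a) * (c - b) * (\<Sum>n. hyp_coeff a b (c + 1) n)"
proof -
  have c1: "Re (c + 1) > 0" "Re (c + 1 - a - b) > 0" using c d by auto
  have nz: "c + of_nat n \<noteq> 0" for n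
  proof
    assume "c + of_nat n = 0"
    then have "Re (c + of_nat n) = 0" by simp
    with c show False by simp
  qed
  have shift: "hyp_coeff a b (c + 1) n = hyp_coeff a b c n * c / (c + of_nat n)" for n
  proof -
    have "pochhammer c n * (c + of_nat n) = c * pochhammer (c + 1) n"
      using pochhammer_rec[of c n] by (simp add: pochhammer_Suc)
    then have "pochhammer (c + 1) n = pochhammer c n * (c + of_nat n) / c"
      using nz[of 0] by (simp add: field_simps)
    then show ?thesis by (simp add: hyp_coeff_def)
  qed
  have sm: "summable (hyp_coeff a b c)" "summable (hyp_coeff a b (c + 1))"
    using c c1 d
    by (auto intro!: summable_norm_cancel[OF summable_norm_hyp_coeff] Re_pos_not_nonpos_Ints)
  \<comment> \<open>Gosper-type telescoping with the certificate \<open>n * hyp_coeff a b c n\<close>.\<close>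
  have "(c - a - b) * c * hyp_coeff a b c n - (c - a) * (c - b) * hyp_coeff a b (c + 1) n =
        - c * (of_nat (Suc n) * hyp_coeff a b c (Suc n) - of_nat n * hyp_coeff a b c n)" for n
  proof -
    have "(c - a - b) * c - (c - a) * (c - b) * (c / (c + of_nat n)) =
          - c * ((a + of_nat n) * (b + of_nat n) / (c + of_nat n) - of_nat n)"
      using nz[of n] by (simp add: divide_simps) algebra
    then have "hyp_coeff a b c n * ((c - a - b) * c - (c - a) * (c - b) * (c / (c + of_nat n))) =
          hyp_coeff a b c n * (- c * ((a + of_nat n) * (b + of_nat n) / (c + of_nat n) - of_nat n))"
      by simp
    moreover have "of_nat (Suc n) * hyp_coeff a b c (Suc n) =
        hyp_coeff a b c n * ((a + of_nat n) * (b + of_nat n) / (c + of_nat n))"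
      unfolding hyp_coeff_Suc using nz[of n] by (simp add: divide_simps del: of_nat_Suc)
    ultimately show ?thesis
      unfolding shift by (simp add: right_diff_distrib left_diff_distrib diff_divide_distrib mult_ac)
  qed
  \<comment> \<open>In \<open>0 - 0\<close> the first zero is the limit of the certificate and the
    second is its value at n = 0.\<close>
  moreover have "(\<lambda>n. - c * (of_nat (Suc n) * hyp_coeff a b c (Suc n) - of_nat n * hyp_coeff a b c n)) sums (- c * (0 - 0))"
    using telescope_sums[OF of_nat_times_hyp_coeff_tendsto_0[OF Re_pos_not_nonpos_Ints[OF c] d]]
    by (intro sums_mult) simp
  ultimately have "(\<lambda>n. (c - a - b) * c * hyp_coeff a b c n - (c - a) * (c - b) * hyp_coeff a b (c + 1) n) sums 0"
    by simp
  moreover have "(\<lambda>n. (c - a - b) * c * hyp_coeff a b c n - (c - a) * (c - b) * hyp_coeff a b (c + 1) n) sums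
      ((c - a - b) * c * (\<Sum>n. hyp_coeff a b c n) - (c - a) * (c - b) * (\<Sum>n. hyp_coeff a b (c + 1) n))"
    using sm by (intro sums_diff sums_mult summable_sums)
  ultimately show ?thesis
    using sums_unique2 by (fastforce simp: mult.commute)
qed

text \<open>Iterating the contiguous relation m times expresses the sum through Pochhammer symbols
  and the sum with c + m in place of c. As m tends to infinity the former, rescaled, converge to
  reciprocal Gamma values and the latter tends to 1.\<close>

theorem Gauss_summation:
  assumes c: "Re c > 0" and d: "Re (c - a - b) > 0"
  shows "hyp_coeff a b c sums (Gamma c * Gamma (c - a - b) * rGamma (c - a) * rGamma (c - b))"
proof -
  define S where "S m = (\<Sum>n. hyp_coeff a b (c + of_nat m) n)" for m
  have iter: "S 0 * (pochhammer (c - a - b) m * pochhammer c m) =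
              pochhammer (c - a) m * pochhammer (c - b) m * S m" for m
  proof (induction m)
    case (Suc m)
    have step: "S m * ((c - a - b + of_nat m) * (c + of_nat m)) =
          (c - a + of_nat m) * (c - b + of_nat m) * S (Suc m)"
      using Gauss_step[of "c + of_nat m" a b] c d by (simp add: S_def algebra_simps)
    have "S 0 * (pochhammer (c - a - b) (Suc m) * pochhammer c (Suc m)) =
          (S 0 * (pochhammer (c - a - b) m * pochhammer c m)) * ((c - a - b + of_nat m) * (c + of_nat m))"
      by (simp add: pochhammer_Suc)
    also have "\<dots> = pochhammer (c - a) m * pochhammer (c - b) m * (S m * ((c - a - b + of_nat m) * (c + of_nat m)))"
      by (simp add: Suc)
    also have "\<dots> = pochhammer (c - a) (Suc m) * pochhammer (c - b) (Suc m) * S (Suc m)"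
      unfolding step by (simp add: pochhammer_Suc)
    finally show ?case .
  qed simp
  \<comment> \<open>Both sides carry the same factorials and the same power of m, because (c - a -
    b) + c = (c - a) + (c - b). After m + 1 iterations the normalisation of
    \<open>rGamma_series\<close> therefore cancels.\<close>
  have iter': "S 0 * (rGamma_series (c - a - b) m * rGamma_series c m) =
               rGamma_series (c - a) m * rGamma_series (c - b) m * S (Suc m)" for m
  proof -
    let ?e = "\<lambda>z::complex. exp (z * of_real (ln (real m)))"
    have "?e (c - a - b) * ?e c = ?e (c - a) * ?e (c - b)"
      by (simp flip: exp_add add: algebra_simps)
    then show ?thesis
      using iter[of "Suc m"] unfolding rGamma_series_def by (simp add: divide_simps mult_ac)
  qed
  \<comment> \<open>Tannery's theorem, with the unshifted coefficients as summable majorant, allows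
    the limit to be taken termwise; only the constant term survives.\<close>
  have "S \<longlonglongrightarrow> (\<Sum>n. if n = 0 then 1 else 0)"
    unfolding S_def
  proof (rule tannerys_theorem[THEN conjunct2, THEN conjunct2])
    show "(\<lambda>m. hyp_coeff a b (c + of_nat m) n) \<longlonglongrightarrow> (if n = 0 then 1 else 0)" for n
      by (rule hyp_coeff_shift_tendsto)
    show "summable (\<lambda>n. norm (hyp_coeff a b c n))"
      using c d by (intro summable_norm_hyp_coeff Re_pos_not_nonpos_Ints)
    have "norm (hyp_coeff a b (c + of_nat m) n) \<le> norm (hyp_coeff a b c n)" for n m
    proof -
      have "0 < norm (pochhammer c n)"
        using Re_pos_not_nonpos_Ints[OF c] by (auto dest: pochhammer_eq_0_imp_nonpos_Int)
      then show ?thesis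
        using norm_pochhammer_mono[OF c, of n m] unfolding hyp_coeff_def norm_divide norm_mult
        by (intro divide_left_mono mult_right_mono mult_pos_pos mult_nonneg_nonneg) auto
    qed
    then show "\<forall>\<^sub>F (n, m) in sequentially \<times>\<^sub>F sequentially.
                 norm (hyp_coeff a b (c + of_nat m) n) \<le> norm (hyp_coeff a b c n)"
      by (simp add: case_prod_unfold)
  qed simp
  also have "(\<Sum>n. if n = 0 then 1 else 0 :: complex) = 1"
    using suminf_finite[of "{0::nat}" "\<lambda>n. if n = 0 then 1 else 0 :: complex"] by simp
  finally have S_lim: "(\<lambda>m. S (Suc m)) \<longlonglongrightarrow> 1" by (rule LIMSEQ_Suc)
  have "S 0 * (rGamma (c - a - b) * rGamma c) = rGamma (c - a) * rGamma (c - b) * 1"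
  proof (rule LIMSEQ_unique)
    show "(\<lambda>m. S 0 * (rGamma_series (c - a - b) m * rGamma_series c m)) \<longlonglongrightarrow> S 0 * (rGamma (c - a - b) * rGamma c)"
      by (intro tendsto_intros)
    show "(\<lambda>m. S 0 * (rGamma_series (c - a - b) m * rGamma_series c m)) \<longlonglongrightarrow> rGamma (c - a) * rGamma (c - b) * 1"
      unfolding iter' by (intro tendsto_mult rGamma_series_LIMSEQ S_lim)
  qed
  moreover have "rGamma c \<noteq> 0" "rGamma (c - a - b) \<noteq> 0"
    using c d Re_pos_not_nonpos_Ints by (auto simp: rGamma_eq_zero_iff)
  ultimately have "S 0 = Gamma c * Gamma (c - a - b) * rGamma (c - a) * rGamma (c - b)"
    by (simp add: Gamma_def field_simps)
  moreover have "hyp_coeff a b c sums S 0"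
    unfolding S_def using summable_norm_hyp_coeff[OF Re_pos_not_nonpos_Ints[OF c] d]
    by (simp add: summable_norm_cancel summable_sums)
  ultimately show ?thesis by simp
qed

subsection \<open>The hypergeometric series and the slit plane\<close>

abbreviation hyp_series :: "complex \<Rightarrow> complex \<Rightarrow> complex \<Rightarrow> complex \<Rightarrow> complex" where
  "hyp_series a b c \<equiv> eval_fps (fps_hypergeo [a, b] [c] 1)"

abbreviation slit_plane :: "complex set" where
  "slit_plane \<equiv> - complex_of_real ` {1..}"

lemma slit_plane_iff: "z \<in> slit_plane \<longleftrightarrow> Im z \<noteq> 0 \<or> Re z < 1"
proof
  assume "z \<in> slit_plane"
  then have "z \<noteq> of_real (Re z) \<or> \<not> 1 \<le> Re z" by (metis ComplI atLeast_iff image_eqI ComplD)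
  then show "Im z \<noteq> 0 \<or> Re z < 1" by (auto simp: complex_eq_iff)
qed auto

lemma open_slit_plane: "open slit_plane"
proof -
  have "slit_plane = {z. Im z < 0} \<union> {z. Im z > 0} \<union> {z. Re z < 1}"
    unfolding set_eq_iff slit_plane_iff by auto
  then show ?thesis
    by (auto intro!: open_halfspace_Im_lt open_halfspace_Im_gt open_halfspace_Re_lt)
qed

text \<open>Used twice: it makes the slit plane starlike about 0, and it keeps 1 - z t off the
  branch cut of the principal power for t in [0,1].\<close>

lemma scale_slit_plane:
  assumes "z \<in> slit_plane" "0 \<le> t" "t \<le> 1"
  shows "of_real t * z \<in> slit_plane"
proof (cases "t = 0")
  case False
  then have t: "t > 0" using assms by simp
  have "t * Re z < 1" if "Re z < 1"
  proof (cases "Re z \<ge> 0")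
    case True
    then have "t * Re z \<le> 1 * Re z" using assms by (intro mult_right_mono) auto
    then show ?thesis using that by simp
  next
    case False
    then have "t * Re z \<le> 0" using t by (simp add: mult_nonneg_nonpos)
    then show ?thesis by simp
  qed
  then show ?thesis using assms(1) t unfolding slit_plane_iff by auto
next
  case True
  then show ?thesis unfolding slit_plane_iff by simp
qed

text \<open>Starlikeness gives connectedness, for the identity theorem, as well as primitives of
  holomorphic functions, for lowering the parameters.\<close>

lemma starlike_slit_plane: "starlike slit_plane"
proof -
  have "closed_segment 0 z \<subseteq> slit_plane" if "z \<in> slit_plane" for z
  proof
    fix w assume "w \<in> closed_segment 0 z"
    then obtain u where u: "0 \<le> u" "u \<le> 1" "w = of_real u * z"
      unfolding in_segment by (auto simp: scaleR_conv_of_real)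
    show "w \<in> slit_plane" unfolding u(3) by (rule scale_slit_plane[OF that u(1,2)])
  qed
  moreover have "0 \<in> slit_plane" unfolding slit_plane_iff by simp
  ultimately show ?thesis unfolding starlike_def by blast
qed

lemma connected_slit_plane: "connected slit_plane"
  by (rule starlike_imp_connected[OF starlike_slit_plane])

lemma ball_subset_slit_plane: "ball 0 1 \<subseteq> slit_plane"
proof
  fix z :: complex assume "z \<in> ball 0 1"
  then show "z \<in> slit_plane"
    using complex_Re_le_cmod[of z] unfolding slit_plane_iff by auto
qed

lemma one_minus_slit_plane: "z \<in> slit_plane \<Longrightarrow> 1 - z \<notin> \<real>\<^sub>\<le>\<^sub>0"
  unfolding slit_plane_iff complex_nonpos_Reals_iff by auto

text \<open>The ratio of consecutive terms tends to z, since (x + n) / (y + n) = 1 + (x - y) / (y +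
  n) tends to 1. The ratio test then works with any C strictly between |z| and 1.\<close>

lemma summable_norm_hyp_series:
  assumes c: "c \<notin> \<int>\<^sub>\<le>\<^sub>0" and z: "norm z < 1"
  shows "summable (\<lambda>n. norm (hyp_coeff a b c n * z ^ n))"
proof -
  obtain C where C: "norm z < C" "C < 1" using z dense by blast
  have inf: "filterlim (\<lambda>n. x + of_nat n :: complex) at_infinity sequentially" for x
    by (intro tendsto_add_filterlim_at_infinity[OF tendsto_const] tendsto_of_nat)
  have frac: "(\<lambda>n. (x + of_nat n) / (y + of_nat n)) \<longlonglongrightarrow> 1" if "y \<notin> \<int>\<^sub>\<le>\<^sub>0" for x y :: complex
  proof -
    have nz: "y + of_nat n \<noteq> 0" for n
      using that by (metis add.commute add_eq_0_iff minus_of_nat_in_nonpos_Ints)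
    have "(\<lambda>n. 1 + (x - y) / (y + of_nat n)) \<longlonglongrightarrow> 1 + 0"
      by (intro tendsto_add tendsto_const tendsto_divide_0[OF tendsto_const inf])
    also have "(\<lambda>n. 1 + (x - y) / (y + of_nat n)) = (\<lambda>n. (x + of_nat n) / (y + of_nat n))"
      using nz by (auto simp: field_simps)
    finally show ?thesis by simp
  qed
  have "(\<lambda>n. norm ((a + of_nat n) / (c + of_nat n) * ((b + of_nat n) / (1 + of_nat n)) * z)) \<longlonglongrightarrow> norm (1 * 1 * z)"
    by (intro tendsto_intros frac c) auto
  then have "\<forall>\<^sub>F n in sequentially. norm ((a + of_nat n) / (c + of_nat n) * ((b + of_nat n) / (1 + of_nat n)) * z) < C"
    using C by (intro order_tendstoD(2)) auto
  then obtain N where N: "\<And>n. n \<ge> N \<Longrightarrow> norm ((a + of_nat n) / (c + of_nat n) * ((b + of_nat n) / (1 + of_nat n)) * z) < C"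
    by (auto simp: eventually_sequentially)
  show ?thesis
  proof (rule summable_ratio_test[OF C(2)])
    fix n assume "n \<ge> N"
    have "hyp_coeff a b c (Suc n) * z ^ Suc n =
        ((a + of_nat n) / (c + of_nat n) * ((b + of_nat n) / (1 + of_nat n)) * z) * (hyp_coeff a b c n * z ^ n)"
      by (simp add: hyp_coeff_Suc)
    then have "norm (hyp_coeff a b c (Suc n) * z ^ Suc n) =
        norm ((a + of_nat n) / (c + of_nat n) * ((b + of_nat n) / (1 + of_nat n)) * z) * norm (hyp_coeff a b c n * z ^ n)"
      by (metis norm_mult)
    also have "\<dots> \<le> C * norm (hyp_coeff a b c n * z ^ n)"
      using N[OF \<open>n \<ge> N\<close>] by (intro mult_right_mono) auto
    finally show "norm (norm (hyp_coeff a b c (Suc n) * z ^ Suc n)) \<le> C * norm (norm (hyp_coeff a b c n * z ^ n))"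
      by simp
  qed
qed

lemma hyp_series_sums:
  assumes c: "c \<notin> \<int>\<^sub>\<le>\<^sub>0" and z: "norm z < 1"
  shows "(\<lambda>n. hyp_coeff a b c n * z ^ n) sums hyp_series a b c z"
  unfolding eval_fps_def fps_nth_hypergeo_2_1
  by (rule summable_sums[OF summable_norm_cancel[OF summable_norm_hyp_series[OF assms]]])

lemma fps_conv_radius_hypergeo:
  fixes a b c :: complex
  assumes c: "c \<notin> \<int>\<^sub>\<le>\<^sub>0"
  shows "fps_conv_radius (fps_hypergeo [a, b] [c] 1) \<ge> 1"
  unfolding fps_conv_radius_def
proof (rule conv_radius_geI_ex)
  fix r :: real assume "0 < r" "ereal r < 1"
  then show "\<exists>z. norm z = r \<and> summable (\<lambda>n. fps_nth (fps_hypergeo [a, b] [c] 1) n * z ^ n)"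
    unfolding fps_nth_hypergeo_2_1 using hyp_series_sums[OF c, of "of_real r" a b]
    by (intro exI[of _ "of_real r"]) (auto simp: sums_iff)
qed

lemma has_fps_expansion_hyp_series:
  assumes "c \<notin> \<int>\<^sub>\<le>\<^sub>0"
  shows "hyp_series a b c has_fps_expansion fps_hypergeo [a, b] [c] 1"
proof -
  have "(0::ereal) < 1" by simp
  also have "1 \<le> fps_conv_radius (fps_hypergeo [a, b] [c] 1)"
    by (rule fps_conv_radius_hypergeo[OF assms])
  finally show ?thesis by (simp add: has_fps_expansion_def)
qed

section \<open>The derivative of the series and descent of the parameters\<close>

lemma hyp_coeff_deriv:
  "of_nat (Suc n) * hyp_coeff a b c (Suc n) = a * b / c * hyp_coeff (a + 1) (b + 1) (c + 1) n"
proof -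
  have "(of_nat (Suc n) :: complex) \<noteq> 0" by (rule of_nat_neq_0)
  then show ?thesis
    unfolding hyp_coeff_def pochhammer_rec fact_Suc of_nat_mult by (simp del: of_nat_Suc)
qed

lemma has_field_derivative_hyp_series:
  assumes c: "c \<notin> \<int>\<^sub>\<le>\<^sub>0" and z: "norm z < 1"
  shows "(hyp_series a b c has_field_derivative a * b / c * hyp_series (a + 1) (b + 1) (c + 1) z) (at z)"
proof -
  have c1: "c + 1 \<notin> \<int>\<^sub>\<le>\<^sub>0" using c plus_one_in_nonpos_Ints_imp by blast
  have "(hyp_series a b c has_field_derivative eval_fps (fps_deriv (fps_hypergeo [a, b] [c] 1)) z) (at z)"
    using fps_conv_radius_hypergeo[OF c, of a b] z
    by (intro has_field_derivative_eval_fps) (meson ereal_less(3) less_le_trans)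
  also have "eval_fps (fps_deriv (fps_hypergeo [a, b] [c] 1)) z =
      (\<Sum>n. a * b / c * (hyp_coeff (a + 1) (b + 1) (c + 1) n * z ^ n))"
    unfolding eval_fps_def fps_deriv_nth fps_nth_hypergeo_2_1
    by (intro suminf_cong) (simp only: hyp_coeff_deriv Suc_eq_plus1[symmetric] mult.assoc)
  also have "\<dots> = a * b / c * hyp_series (a + 1) (b + 1) (c + 1) z"
    by (rule sums_unique[OF sums_mult[OF hyp_series_sums[OF c1 z]], symmetric])
  finally show ?thesis .
qed

text \<open>Exactly the existence statement that the choice operator in \<open>hyp2F1\<close>
  needs.\<close>

definition has_slit_continuation :: "complex \<Rightarrow> complex \<Rightarrow> complex \<Rightarrow> bool" where
  "has_slit_continuation a b c \<longleftrightarrow>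
     (\<exists>g. g holomorphic_on slit_plane \<and> (\<forall>z\<in>ball 0 1. g z = hyp_series a b c z))"

text \<open>The continuation with raised parameters has a primitive on the starlike slit plane. Its
  multiple by ab/c has the same derivative as the series on the unit disc, so the two differ there
  by a constant.\<close>

lemma has_slit_continuation_lower:
  assumes c: "c \<notin> \<int>\<^sub>\<le>\<^sub>0" and ex: "has_slit_continuation (a + 1) (b + 1) (c + 1)"
  shows "has_slit_continuation a b c"
proof -
  obtain h where h: "h holomorphic_on slit_plane" "\<And>z. z \<in> ball 0 1 \<Longrightarrow> h z = hyp_series (a + 1) (b + 1) (c + 1) z"
    using ex unfolding has_slit_continuation_def by blast
  obtain H where H: "\<And>z. z \<in> slit_plane \<Longrightarrow> (H has_field_derivative h z) (at z)"
    using holomorphic_starlike_primitive[OF holomorphic_on_imp_continuous_on[OF h(1)] starlike_slit_plane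
        open_slit_plane finite.emptyI] holomorphic_on_imp_differentiable_at[OF h(1) open_slit_plane] by auto
  \<comment> \<open>The constant is chosen so that g takes the value 1 at 0, the constant term of
    the series.\<close>
  define g where "g z = 1 + a * b / c * (H z - H 0)" for z
  have g: "(g has_field_derivative a * b / c * h z) (at z)" if "z \<in> slit_plane" for z
    unfolding g_def by (rule derivative_eq_intros H[OF that] refl)+ simp
  have "g z = hyp_series a b c z" if z: "z \<in> ball 0 1" for z
  proof -
    have "\<exists>k. \<forall>w\<in>ball 0 1. g w - hyp_series a b c w = k"
    proof (rule has_field_derivative_zero_constant)
      fix w :: complex assume w: "w \<in> ball 0 1"
      have "w \<in> slit_plane" using w ball_subset_slit_plane by blast
      then have "((\<lambda>w. g w - hyp_series a b c w) has_field_derivative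
              a * b / c * h w - a * b / c * hyp_series (a + 1) (b + 1) (c + 1) w) (at w)"
        using w c by (intro DERIV_diff g has_field_derivative_hyp_series) auto
      then show "((\<lambda>w. g w - hyp_series a b c w) has_field_derivative 0) (at w within ball 0 1)"
        using h(2)[OF w] by (simp add: has_field_derivative_at_within)
    qed simp
    then obtain k where k: "\<And>w. w \<in> ball 0 1 \<Longrightarrow> g w - hyp_series a b c w = k" by blast
    have "g 0 - hyp_series a b c 0 = 0" by (simp add: g_def eval_fps_at_0)
    with k[of 0] k[OF z] show ?thesis by simp
  qed
  moreover have "g holomorphic_on slit_plane"
    using g open_slit_plane by (auto simp: holomorphic_on_open)
  ultimately show ?thesis unfolding has_slit_continuation_def by blast
qed

lemma has_slit_continuation_lower_iterate:
  assumes "c \<notin> \<int>\<^sub>\<le>\<^sub>0" "has_slit_continuation (a + of_nat n) (b + of_nat n) (c + of_nat n)"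
  shows "has_slit_continuation a b c"
  using assms
proof (induction n arbitrary: a b c)
  case (Suc n)
  have "c + 1 \<notin> \<int>\<^sub>\<le>\<^sub>0" using Suc.prems(1) plus_one_in_nonpos_Ints_imp by blast
  moreover have "has_slit_continuation (a + 1 + of_nat n) (b + 1 + of_nat n) (c + 1 + of_nat n)"
    using Suc.prems(2) by (simp add: add.assoc)
  ultimately have "has_slit_continuation (a + 1) (b + 1) (c + 1)" by (rule Suc.IH)
  with Suc.prems(1) show ?case by (rule has_slit_continuation_lower)
qed simp

subsection \<open>The master integral\<close>

text \<open>Integrating (1-t)^n against the Beta kernel replaces q by q + n. The Pochhammer quotient
  found here exchanges the lower parameter q of the coefficients for p + q.\<close>

lemma Beta_plus_of_nat_right:
  fixes p q :: complex
  assumes "p \<notin> \<int>\<^sub>\<le>\<^sub>0" "q \<notin> \<int>\<^sub>\<le>\<^sub>0" "p + q \<notin> \<int>\<^sub>\<le>\<^sub>0"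
  shows "Beta p (q + of_nat n) = Beta p q * pochhammer q n / pochhammer (p + q) n"
proof -
  have "pochhammer (p + q) n \<noteq> 0" "Gamma q \<noteq> 0"
    using assms by (auto dest: pochhammer_eq_0_imp_nonpos_Int simp: Gamma_eq_zero_iff)
  moreover have "rGamma (p + q) = pochhammer (p + q) n * rGamma (p + q + of_nat n)"
    by (rule pochhammer_rGamma)
  ultimately show ?thesis
    using pochhammer_Gamma[OF assms(2), of n] by (simp add: Beta_altdef field_simps)
qed

text \<open>The real Beta values are themselves multiples of hypergeometric coefficients, so
  \<open>hyp_coeff_bound\<close> controls both factors. The two exponents add up to -1 - Re (p + q -
  A - B), which is below -1.\<close>

lemma summable_norm_hyp_coeff_mult_Beta:
  assumes p: "Re p > 0" and q: "Re q > 0" and d: "Re (p + q - A - B) > 0"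
  shows "summable (\<lambda>n. norm (hyp_coeff A B q n) * Beta (Re p) (Re q + real n))"
proof -
  let ?p = "complex_of_real (Re p)" and ?q = "complex_of_real (Re q)"
  have pq: "?p + ?q \<notin> \<int>\<^sub>\<le>\<^sub>0" using p q by (intro Re_pos_not_nonpos_Ints) auto
  \<comment> \<open>The upper parameter 1 cancels the factorial in \<open>hyp_coeff\<close>, leaving
    only the quotient of the Pochhammer symbols of Re q and Re p + Re q.\<close>
  have Beta_eq: "of_real (Beta (Re p) (Re q + real n)) = Beta ?p ?q * hyp_coeff ?q 1 (?p + ?q) n" for n
    using Beta_plus_of_nat_right[of ?p ?q n] p q pq
    by (simp add: Beta_complex_of_real[symmetric] hyp_coeff_def pochhammer_fact[symmetric] Re_pos_not_nonpos_Ints)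
  obtain K where K: "K > 0" "\<And>n. n > 0 \<Longrightarrow> norm (hyp_coeff A B q (Suc n)) \<le> K * real n powr (Re (A + B - q) - 1)"
    using hyp_coeff_bound[OF Re_pos_not_nonpos_Ints[OF q]] by metis
  obtain L where L: "L > 0" "\<And>n. n > 0 \<Longrightarrow> norm (hyp_coeff ?q 1 (?p + ?q) (Suc n)) \<le> L * real n powr (Re (?q + 1 - (?p + ?q)) - 1)"
    using hyp_coeff_bound[OF pq] by metis
  have "summable (\<lambda>n. norm (norm (hyp_coeff A B q (Suc n)) * norm (hyp_coeff ?q 1 (?p + ?q) (Suc n))))"
  proof (rule summable_comparison_test_ev)
    show "\<forall>\<^sub>F n in sequentially. norm (norm (norm (hyp_coeff A B q (Suc n)) * norm (hyp_coeff ?q 1 (?p + ?q) (Suc n)))) \<le>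
        K * L * real n powr (- 1 - Re (p + q - A - B))"
      using eventually_gt_at_top[of 0]
    proof eventually_elim
      case (elim n)
      have "norm (hyp_coeff A B q (Suc n)) * norm (hyp_coeff ?q 1 (?p + ?q) (Suc n)) \<le>
          (K * real n powr (Re (A + B - q) - 1)) * (L * real n powr (Re (?q + 1 - (?p + ?q)) - 1))"
        using elim K(1) by (intro mult_mono K L) auto
      also have "\<dots> = K * L * real n powr ((Re (A + B - q) - 1) + (Re (?q + 1 - (?p + ?q)) - 1))"
        unfolding powr_add by simp
      also have "(Re (A + B - q) - 1) + (Re (?q + 1 - (?p + ?q)) - 1) = - 1 - Re (p + q - A - B)"
        by simp
      finally show ?case by simp
    qed
    show "summable (\<lambda>n. K * L * real n powr (- 1 - Re (p + q - A - B)))"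
      using d by (intro summable_mult) (simp add: summable_real_powr_iff)
  qed
  then have "summable (\<lambda>n. norm (Beta ?p ?q) * (norm (hyp_coeff A B q n) * norm (hyp_coeff ?q 1 (?p + ?q) n)))"
    by (subst (asm) summable_Suc_iff) (auto intro: summable_mult)
  also have "(\<lambda>n. norm (Beta ?p ?q) * (norm (hyp_coeff A B q n) * norm (hyp_coeff ?q 1 (?p + ?q) n))) =
      (\<lambda>n. norm (hyp_coeff A B q n) * norm (complex_of_real (Beta (Re p) (Re q + real n))))"
    unfolding Beta_eq norm_mult by (simp add: mult_ac)
  also have "\<dots> = (\<lambda>n. norm (hyp_coeff A B q n) * Beta (Re p) (Re q + real n))"
  proof
    fix n
    have "Beta (Re p) (Re q + real n) > 0"
      using p q by (simp add: Beta_def Gamma_real_pos add_pos_nonneg)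
    then show "norm (hyp_coeff A B q n) * norm (complex_of_real (Beta (Re p) (Re q + real n))) =
        norm (hyp_coeff A B q n) * Beta (Re p) (Re q + real n)" by simp
  qed
  finally show ?thesis .
qed

text \<open>The series is used instead of \<open>hyp2F1\<close> because this kernel serves to
  construct the analytic continuation; on (0,1) the argument 1 - t lies in the unit disc
  anyway.\<close>

definition hyp_kernel :: "complex \<Rightarrow> complex \<Rightarrow> complex \<Rightarrow> complex \<Rightarrow> real \<Rightarrow> complex" where
  "hyp_kernel p q A B t =
     of_real t powr (p - 1) * of_real (1 - t) powr (q - 1) * hyp_series A B q (of_real (1 - t))"

lemma of_real_powr_add_of_nat:
  "t > 0 \<Longrightarrow> complex_of_real t powr (s + of_nat n) = of_real t powr s * of_real t ^ n"
  by (simp add: powr_add)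

lemma hyp_kernel_plus_of_nat:
  "t > 0 \<Longrightarrow> hyp_kernel (p + of_nat n) q A B t = of_real t ^ n * hyp_kernel p q A B t"
  using of_real_powr_add_of_nat[of t "p - 1" n] by (simp add: hyp_kernel_def algebra_simps)

text \<open>The series in 1 - t is integrated term by term. The integrals of the norms form a
  convergent series, which yields integrability and the interchange at once; the resulting sum is
  \<open>Beta p q\<close> times a Gauss series with lower parameter p + q at 1.\<close>

lemma
  assumes p: "Re p > 0" and q: "Re q > 0" and d: "Re (p + q - A - B) > 0"
  shows set_integrable_hyp_kernel: "set_integrable lborel {0<..<1} (hyp_kernel p q A B)"
    and set_lebesgue_integral_hyp_kernel:
      "set_lebesgue_integral lborel {0<..<1} (hyp_kernel p q A B) =
         Gamma p * Gamma q * Gamma (p + q - A - B) * rGamma (p + q - A) * rGamma (p + q - B)"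
proof -
  define f where "f n t = indicator {0<..<1} t *\<^sub>R
      (hyp_coeff A B q n * (of_real t powr (p - 1) * of_real (1 - t) powr (q + of_nat n - 1)))" for n and t :: real
  have qn: "Re (q + of_nat n) > 0" for n using q by (simp add: add_pos_nonneg)
  have f_int: "integrable lborel (f n)" for n
    using set_integrable_mult_right[OF set_integrable_Beta_complex[OF p qn[of n]], of "hyp_coeff A B q n"]
    unfolding f_def set_integrable_def by simp
  have f_eq: "f n t = (indicator {0<..<1} t *\<^sub>R (of_real t powr (p - 1) * of_real (1 - t) powr (q - 1))) *
      (hyp_coeff A B q n * of_real (1 - t) ^ n)" for n t
  proof (cases "t \<in> {0<..<1}")
    case True
    then have "complex_of_real (1 - t) powr (q + of_nat n - 1) = of_real (1 - t) powr (q - 1) * of_real (1 - t) ^ n"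
      using of_real_powr_add_of_nat[of "1 - t" "q - 1" n] by (simp add: algebra_simps)
    then show ?thesis unfolding f_def by (simp only: mult_ac scaleR_conv_of_real)
  qed (simp add: f_def)
  have q': "q \<notin> \<int>\<^sub>\<le>\<^sub>0" using q by (rule Re_pos_not_nonpos_Ints)
  have norm_t: "norm (complex_of_real (1 - t)) < 1" if "t \<in> {0<..<1}" for t
    using that unfolding norm_of_real by auto
  have f_summable: "summable (\<lambda>n. norm (f n t))" for t
  proof (cases "t \<in> {0<..<1}")
    case True
    then show ?thesis
      unfolding f_eq norm_mult[of "_ *\<^sub>R _"]
      by (intro summable_mult summable_norm_hyp_series[OF q' norm_t])
  qed (simp add: f_def)
  have f_suminf: "(\<Sum>n. f n t) = indicator {0<..<1} t *\<^sub>R hyp_kernel p q A B t" for t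
  proof (cases "t \<in> {0<..<1}")
    case True
    have "(\<lambda>n. f n t) sums ((indicator {0<..<1} t *\<^sub>R (of_real t powr (p - 1) * of_real (1 - t) powr (q - 1))) *
            hyp_series A B q (of_real (1 - t)))"
      unfolding f_eq by (intro sums_mult hyp_series_sums[OF q' norm_t[OF True]])
    then show ?thesis by (simp add: sums_iff hyp_kernel_def)
  qed (simp add: f_def)
  have f_norm: "(\<integral>t. norm (f n t) \<partial>lborel) = norm (hyp_coeff A B q n) * Beta (Re p) (Re q + real n)" for n
  proof -
    have "norm (f n t) = indicator {0<..<1} t *\<^sub>R
        (norm (hyp_coeff A B q n) * (t powr (Re p - 1) * (1 - t) powr (Re q + real n - 1)))" for t
    proof (cases "t \<in> {0<..<1}")
      case True
      then show ?thesis
        using norm_of_real_powr[of t "p - 1"] norm_of_real_powr[of "1 - t" "q + of_nat n - 1"]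
        unfolding f_def norm_scaleR norm_mult by simp
    qed (simp add: f_def)
    then have "(\<integral>t. norm (f n t) \<partial>lborel) = (LINT t:{0<..<1}|lborel.
        norm (hyp_coeff A B q n) * (t powr (Re p - 1) * (1 - t) powr (Re q + real n - 1)))"
      unfolding set_lebesgue_integral_def by simp
    also have "\<dots> = norm (hyp_coeff A B q n) * Beta (Re p) (Re q + real n)"
      using set_lebesgue_integral_Beta_real[of "Re p" "Re q + real n"] p q by simp
    finally show ?thesis .
  qed
  have f_norm_summable: "summable (\<lambda>n. \<integral>t. norm (f n t) \<partial>lborel)"
    unfolding f_norm by (rule summable_norm_hyp_coeff_mult_Beta[OF p q d])
  show "set_integrable lborel {0<..<1} (hyp_kernel p q A B)"
    using integrable_suminf[OF f_int _ f_norm_summable] f_summable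
    unfolding f_suminf set_integrable_def by simp
  have "(\<lambda>n. integral\<^sup>L lborel (f n)) sums (\<integral>t. indicator {0<..<1} t *\<^sub>R hyp_kernel p q A B t \<partial>lborel)"
    using sums_integral[OF f_int _ f_norm_summable] f_summable unfolding f_suminf by simp
  moreover have "integral\<^sup>L lborel (f n) = Beta p q * hyp_coeff A B (p + q) n" for n
  proof -
    have "integral\<^sup>L lborel (f n) = hyp_coeff A B q n * Beta p (q + of_nat n)"
      using set_lebesgue_integral_Beta_complex[OF p qn[of n]]
      unfolding f_def set_lebesgue_integral_def
      by (simp flip: set_lebesgue_integral_def add: mult_scaleR_right[symmetric] del: mult_scaleR_right)
    also have "Beta p (q + of_nat n) = Beta p q * pochhammer q n / pochhammer (p + q) n"
      using p q by (intro Beta_plus_of_nat_right Re_pos_not_nonpos_Ints) auto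
    finally show ?thesis
      using q' by (auto simp: hyp_coeff_def mult_ac dest: pochhammer_eq_0_imp_nonpos_Int)
  qed
  ultimately have "(\<lambda>n. Beta p q * hyp_coeff A B (p + q) n) sums set_lebesgue_integral lborel {0<..<1} (hyp_kernel p q A B)"
    by (simp add: set_lebesgue_integral_def)
  moreover have "(\<lambda>n. Beta p q * hyp_coeff A B (p + q) n) sums
     (Beta p q * (Gamma (p + q) * Gamma (p + q - A - B) * rGamma (p + q - A) * rGamma (p + q - B)))"
    using p q d by (intro sums_mult Gauss_summation) auto
  ultimately have "set_lebesgue_integral lborel {0<..<1} (hyp_kernel p q A B) =
      Beta p q * (Gamma (p + q) * Gamma (p + q - A - B) * rGamma (p + q - A) * rGamma (p + q - B))"
    by (rule sums_unique2)
  \<comment> \<open>The Gamma (p + q) contributed by Gauss's theorem cancels the denominator of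
    \<open>Beta p q\<close>.\<close>
  moreover have "rGamma (p + q) * Gamma (p + q) = 1"
    using Re_pos_not_nonpos_Ints[of "p + q"] p q by (simp add: Gamma_def rGamma_eq_zero_iff)
  ultimately show "set_lebesgue_integral lborel {0<..<1} (hyp_kernel p q A B) =
         Gamma p * Gamma q * Gamma (p + q - A - B) * rGamma (p + q - A) * rGamma (p + q - B)"
    by (simp add: Beta_altdef algebra_simps)
qed

section \<open>The factor (1 - z t)^(-r) and holomorphy of the integral in z\<close>

lemma one_minus_mult_slit_plane:
  "z \<in> slit_plane \<Longrightarrow> t \<in> {0..1} \<Longrightarrow> 1 - z * complex_of_real t \<notin> \<real>\<^sub>\<le>\<^sub>0"
  using one_minus_slit_plane[OF scale_slit_plane[of z t]] by (simp add: mult.commute)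

lemma continuous_on_slit_plane_powr:
  "continuous_on (slit_plane \<times> {0..1}) (\<lambda>(z, t). (1 - z * complex_of_real t) powr s)"
proof -
  have *: "1 - fst x * complex_of_real (snd x) \<notin> \<real>\<^sub>\<le>\<^sub>0" if "x \<in> slit_plane \<times> {0..1}" for x
    using one_minus_mult_slit_plane[of "fst x" "snd x"] that by (simp add: mem_Times_iff)
  have "continuous_on (slit_plane \<times> {0..1}) (\<lambda>x. exp (s * Ln (1 - fst x * complex_of_real (snd x))))"
    using * by (intro continuous_intros) blast
  moreover have "exp (s * Ln (1 - fst x * complex_of_real (snd x))) = (\<lambda>(z, t). (1 - z * complex_of_real t) powr s) x"
    if "x \<in> slit_plane \<times> {0..1}" for x
  proof -
    have "1 - fst x * complex_of_real (snd x) \<noteq> 0" using *[OF that] by (metis nonpos_Reals_zero_I)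
    then show ?thesis by (simp add: powr_def case_prod_unfold)
  qed
  ultimately show ?thesis by (rule continuous_on_eq)
qed

lemma slit_plane_powr_bounded:
  assumes "K \<subseteq> slit_plane" "compact K"
  obtains C where "\<And>z t. z \<in> K \<Longrightarrow> t \<in> {0..1} \<Longrightarrow> norm ((1 - z * complex_of_real t) powr s) \<le> C"
proof -
  have "compact ((\<lambda>(z, t). (1 - z * complex_of_real t) powr s) ` (K \<times> {0..1}))"
    using assms
    by (intro compact_continuous_image compact_Times continuous_on_subset[OF continuous_on_slit_plane_powr]) auto
  then obtain C where "\<And>w. w \<in> (\<lambda>(z, t). (1 - z * complex_of_real t) powr s) ` (K \<times> {0..1}) \<Longrightarrow> norm w \<le> C"
    using compact_imp_bounded bounded_iff by metis
  then show ?thesis by (intro that[of C]) force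
qed

lemma set_borel_measurable_mult_continuous:
  fixes f g :: "real \<Rightarrow> complex"
  assumes "set_borel_measurable lborel S f" "continuous_on S g" "S \<in> sets borel"
  shows "set_borel_measurable lborel S (\<lambda>t. f t * g t)"
proof -
  have "(\<lambda>t. (indicator S t *\<^sub>R f t) * (indicator S t *\<^sub>R g t)) \<in> borel_measurable lborel"
    using assms(1) set_borel_measurable_lborel_continuous[OF assms(2,3)]
    unfolding set_borel_measurable_def by (rule borel_measurable_times)
  also have "(\<lambda>t. (indicator S t *\<^sub>R f t) * (indicator S t *\<^sub>R g t)) = (\<lambda>t. indicator S t *\<^sub>R (f t * g t))"
    by (auto simp: indicator_def)
  finally show ?thesis unfolding set_borel_measurable_def .
qed

text \<open>Holomorphy holds for an arbitrary exponent r. The closed form is obtained for r = p + q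
  - A, where the result collapses to a Gauss function.\<close>

definition hyp_integrand where
  "hyp_integrand p q A B r z t = hyp_kernel p q A B t * (1 - z * complex_of_real t) powr (- r)"

context
  fixes p q A B r :: complex
  assumes p: "Re p > 0" and q: "Re q > 0" and d: "Re (p + q - A - B) > 0"
begin

lemma set_borel_measurable_hyp_integrand:
  assumes "z \<in> slit_plane"
  shows "set_borel_measurable lborel {0<..<1} (hyp_integrand p q A B r z)"
  unfolding hyp_integrand_def
proof (rule set_borel_measurable_mult_continuous)
  show "set_borel_measurable lborel {0<..<1} (hyp_kernel p q A B)"
    using set_integrable_hyp_kernel[OF p q d] by (auto simp: set_integrable_def set_borel_measurable_def)
  show "continuous_on {0<..<1} (\<lambda>t. (1 - z * complex_of_real t) powr (- r))"
    using assms
    by (intro continuous_on_compose2[OF continuous_on_slit_plane_powr, of _ "\<lambda>t. (z, t)", simplified]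
        continuous_intros) auto
qed simp

text \<open>For z in a closed ball inside the slit plane and t in [0,1] the power ranges over a
  compact set, so a constant multiple of the norm of the kernel is an integrable majorant.\<close>

lemma hyp_integrand_local_bound:
  assumes "z0 \<in> slit_plane"
  shows "\<exists>\<rho>>0. \<exists>g. ball z0 \<rho> \<subseteq> slit_plane \<and> set_integrable lborel {0<..<1} g \<and>
           (\<forall>z\<in>ball z0 \<rho>. \<forall>t\<in>{0<..<1}. norm (hyp_integrand p q A B r z t) \<le> g t)"
proof -
  obtain \<rho> where \<rho>: "\<rho> > 0" "cball z0 \<rho> \<subseteq> slit_plane"
    using open_contains_cball open_slit_plane assms by metis
  obtain C where C: "\<And>z t. z \<in> cball z0 \<rho> \<Longrightarrow> t \<in> {0..1} \<Longrightarrow> norm ((1 - z * complex_of_real t) powr (- r)) \<le> C"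
    using slit_plane_powr_bounded[OF \<rho>(2) compact_cball] by metis
  have "set_integrable lborel {0<..<1} (\<lambda>t. norm (hyp_kernel p q A B t) * C)"
    by (intro set_integrable_mult_left set_integrable_norm set_integrable_hyp_kernel p q d)
  moreover have "norm (hyp_integrand p q A B r z t) \<le> norm (hyp_kernel p q A B t) * C"
    if "z \<in> ball z0 \<rho>" "t \<in> {0<..<1}" for z t
    unfolding hyp_integrand_def norm_mult using that by (intro mult_left_mono C) auto
  moreover have "ball z0 \<rho> \<subseteq> slit_plane" using \<rho>(2) ball_subset_cball by blast
  ultimately show ?thesis using \<rho>(1) by blast
qed

lemma set_integrable_hyp_integrand:
  assumes "z \<in> slit_plane"
  shows "set_integrable lborel {0<..<1} (hyp_integrand p q A B r z)"
proof -
  obtain \<rho> g where g: "\<rho> > 0" "set_integrable lborel {0<..<1} g"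
    "\<And>w t. w \<in> ball z \<rho> \<Longrightarrow> t \<in> {0<..<1} \<Longrightarrow> norm (hyp_integrand p q A B r w t) \<le> g t"
    using hyp_integrand_local_bound[OF assms] by blast
  show ?thesis
  proof (rule set_integrable_bound[OF g(2) set_borel_measurable_hyp_integrand[OF assms]])
    have "norm (hyp_integrand p q A B r z t) \<le> norm (g t)" if "t \<in> {0<..<1}" for t
      using g(3)[OF _ that, of z] g(1) by simp
    then show "AE t in lborel. t \<in> {0<..<1} \<longrightarrow> norm (hyp_integrand p q A B r z t) \<le> norm (g t)"
      by (intro AE_I2 impI)
  qed
qed

lemma holomorphic_hyp_integral:
  "(\<lambda>z. set_lebesgue_integral lborel {0<..<1} (hyp_integrand p q A B r z)) holomorphic_on slit_plane"
proof (rule holomorphic_on_set_lebesgue_integral[OF open_slit_plane])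
  show "(\<lambda>z. hyp_integrand p q A B r z t) holomorphic_on slit_plane" if "t \<in> {0<..<1}" for t
    unfolding hyp_integrand_def using that one_minus_mult_slit_plane
    by (intro holomorphic_intros) auto
qed (use set_borel_measurable_hyp_integrand hyp_integrand_local_bound in auto)

text \<open>In the binomial expansion of (1 - z t)^(-r) the factor t^n merely raises p to p + n, so
  every term is a known kernel integral. In general a 3F2 would appear; the choice r = p + q - A
  cancels one upper against one lower parameter.\<close>

lemma hyp_integral_eq_hyp_series:
  assumes r: "r = p + q - A" and c: "p + q - B \<notin> \<int>\<^sub>\<le>\<^sub>0" and z: "norm z < 1"
  shows "set_lebesgue_integral lborel {0<..<1} (hyp_integrand p q A B r z) =
     Gamma p * Gamma q * Gamma (p + q - A - B) * rGamma (p + q - A) * rGamma (p + q - B) *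
     hyp_series p (p + q - A - B) (p + q - B) z"
proof -
  define K where "K = Gamma p * Gamma q * Gamma (p + q - A - B) * rGamma (p + q - A) * rGamma (p + q - B)"
  define v where "v n = (- r gchoose n) * (- z) ^ n" for n
  have v_sum: "(\<lambda>n. v n * of_real t ^ n) sums (1 - z * of_real t) powr (- r)" if "t \<in> {0<..<1}" for t
  proof -
    have "norm (z * of_real t) \<le> norm z * 1"
      unfolding norm_mult using that by (intro mult_left_mono) auto
    then have "norm (- z * of_real t) < 1" using z by (simp add: norm_mult)
    from gen_binomial_complex[OF this, of "- r"] show ?thesis
      by (simp add: v_def power_mult_distrib power_minus[of z] power_minus[of "z * _"] mult_ac)
  qed
  \<comment> \<open>Since t^n <= 1 on the interval, absolute convergence of the binomial series at
    |z| < 1 bounds the terms uniformly in t.\<close>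
  have v_summable: "summable (\<lambda>n. norm (v n))"
  proof -
    have "summable (\<lambda>n. norm (fps_nth (fps_binomial (- r)) n * (- z) ^ n))"
    proof (rule abs_summable_in_conv_radius, fold fps_conv_radius_def)
      show "ereal (norm (- z)) < fps_conv_radius (fps_binomial (- r))"
        using z unfolding fps_conv_radius_binomial by simp
    qed
    then show ?thesis by (simp add: v_def)
  qed
  define f where "f n t = indicator {0<..<1} t *\<^sub>R (v n * hyp_kernel (p + of_nat n) q A B t)" for n and t :: real
  have pn: "Re (p + of_nat n) > 0" "Re (p + of_nat n + q - A - B) > 0" for n
    using p d by (simp_all add: add_pos_nonneg)
  have f_eq: "f n t = (indicator {0<..<1} t *\<^sub>R hyp_kernel p q A B t) * (v n * of_real t ^ n)" for n t
    by (cases "t \<in> {0<..<1}") (auto simp: f_def hyp_kernel_plus_of_nat)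
  have f_int: "integrable lborel (f n)" for n
    using set_integrable_mult_right[OF set_integrable_hyp_kernel[OF pn(1) q pn(2)], of "v n" n]
    unfolding f_def set_integrable_def by simp
  have f_le: "norm (f n t) \<le> norm (indicator {0<..<1} t *\<^sub>R hyp_kernel p q A B t) * norm (v n)" for n t
  proof (cases "t \<in> {0<..<1}")
    case True
    then have "norm (v n) * t ^ n \<le> norm (v n) * 1"
      by (intro mult_left_mono power_le_one) auto
    with True show ?thesis
      unfolding f_eq norm_mult by (intro mult_left_mono) (auto simp: norm_power)
  qed (simp add: f_def)
  have f_summable: "summable (\<lambda>n. norm (f n t))" for t
    using f_le[of _ t] by (intro summable_comparison_test'[OF summable_mult[OF v_summable]]) auto
  have k_int: "integrable lborel (\<lambda>t. norm (indicator {0<..<1} t *\<^sub>R hyp_kernel p q A B t))"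
    using set_integrable_hyp_kernel[OF p q d] unfolding set_integrable_def by (rule integrable_norm)
  have f_norm_summable: "summable (\<lambda>n. \<integral>t. norm (f n t) \<partial>lborel)"
  proof (rule summable_comparison_test')
    show "summable (\<lambda>n. (\<integral>t. norm (indicator {0<..<1} t *\<^sub>R hyp_kernel p q A B t) \<partial>lborel) * norm (v n))"
      by (intro summable_mult v_summable)
    show "norm (\<integral>t. norm (f n t) \<partial>lborel) \<le>
        (\<integral>t. norm (indicator {0<..<1} t *\<^sub>R hyp_kernel p q A B t) \<partial>lborel) * norm (v n)" for n
      using integral_mono[OF integrable_norm[OF f_int] integrable_mult_left[OF k_int] f_le]
      by (simp add: integral_nonneg_AE)
  qed
  have f_suminf: "(\<Sum>n. f n t) = indicator {0<..<1} t *\<^sub>R hyp_integrand p q A B r z t" for t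
  proof (cases "t \<in> {0<..<1}")
    case True
    have "(\<lambda>n. f n t) sums ((indicator {0<..<1} t *\<^sub>R hyp_kernel p q A B t) * (1 - z * of_real t) powr (- r))"
      unfolding f_eq by (intro sums_mult v_sum True)
    then show ?thesis by (simp add: sums_iff hyp_integrand_def)
  qed (simp add: f_def)
  have J_sums: "(\<lambda>n. integral\<^sup>L lborel (f n)) sums set_lebesgue_integral lborel {0<..<1} (hyp_integrand p q A B r z)"
    using sums_integral[OF f_int _ f_norm_summable] f_summable
    unfolding f_suminf set_lebesgue_integral_def by simp
  have f_val: "integral\<^sup>L lborel (f n) = K * (hyp_coeff p (p + q - A - B) (p + q - B) n * z ^ n)" for n
  proof -
    have "(- 1) ^ n * (- z) ^ n = z ^ n" by (simp flip: power_mult_distrib)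
    then have v_eq: "v n = pochhammer r n * z ^ n / fact n"
      by (simp add: v_def gbinomial_pochhammer)
    have *: "Gamma (s + of_nat n) = pochhammer s n * Gamma s" if "Re s > 0" for s
      using pochhammer_Gamma[OF Re_pos_not_nonpos_Ints[OF that], of n]
        Re_pos_not_nonpos_Ints[OF that] by (simp add: Gamma_eq_zero_iff)
    have "integral\<^sup>L lborel (f n) = v n * set_lebesgue_integral lborel {0<..<1} (hyp_kernel (p + of_nat n) q A B)"
      unfolding f_def set_lebesgue_integral_def[symmetric] by simp
    also have "\<dots> = v n * (Gamma (p + of_nat n) * Gamma q * Gamma ((p + q - A - B) + of_nat n) *
        rGamma (r + of_nat n) * rGamma ((p + q - B) + of_nat n))"
      unfolding set_lebesgue_integral_hyp_kernel[OF pn(1) q pn(2)] r by (simp add: algebra_simps)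
    also have "\<dots> = (pochhammer r n * rGamma (r + of_nat n)) * z ^ n / fact n *
        (Gamma (p + of_nat n) * Gamma q * Gamma ((p + q - A - B) + of_nat n)) * rGamma ((p + q - B) + of_nat n)"
      unfolding v_eq by (simp add: mult_ac)
    \<comment> \<open>This is the cancellation for which r was chosen: the product does not depend
      on n.\<close>
    also have "pochhammer r n * rGamma (r + of_nat n) = rGamma (p + q - A)"
      using pochhammer_rGamma[of r n] by (simp add: r)
    also have "rGamma ((p + q - B) + of_nat n) = rGamma (p + q - B) / pochhammer (p + q - B) n"
      using pochhammer_rGamma[of "p + q - B" n] c by (auto simp: field_simps dest: pochhammer_eq_0_imp_nonpos_Int)
    finally show ?thesis
      unfolding *[OF p] *[OF d] by (simp add: K_def hyp_coeff_def mult_ac)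
  qed
  have K_sums: "(\<lambda>n. K * (hyp_coeff p (p + q - A - B) (p + q - B) n * z ^ n)) sums
      (K * hyp_series p (p + q - A - B) (p + q - B) z)"
    by (intro sums_mult hyp_series_sums c z)
  show ?thesis
    using sums_unique2[OF J_sums[unfolded f_val] K_sums] by (simp only: K_def)
qed

end

subsection \<open>Analytic continuation\<close>

text \<open>The parameters of the integral are solved for: p = a, A = c - b and B = a + q - c
  produce the function with parameters a, b and c, and q remains free.\<close>

lemma has_slit_continuation_Re_pos:
  assumes a: "Re a > 0" and b: "Re b > 0" and c: "c \<notin> \<int>\<^sub>\<le>\<^sub>0"
  shows "has_slit_continuation a b c"
proof -
  \<comment> \<open>Any sufficiently large \<open>q\<close> gives an integral representation with a nonvanishing constant.\<close>
  define q where "q = complex_of_real (1 + \<bar>Re (c - a - b)\<bar>)"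
  define A B where "A = c - b" and "B = a + q - c"
  have q: "Re q > 0" and r: "Re (a + q - A) > 0" using a by (auto simp: q_def A_def)
  have AB: "a + q - A - B = b" "a + q - B = c" by (simp_all add: A_def B_def)
  define K where "K = Gamma a * Gamma q * Gamma b * rGamma (a + q - A) * rGamma c"
  have "K \<noteq> 0"
    using Re_pos_not_nonpos_Ints[OF a] Re_pos_not_nonpos_Ints[OF b] Re_pos_not_nonpos_Ints[OF q]
      Re_pos_not_nonpos_Ints[OF r] c by (simp add: K_def Gamma_eq_zero_iff rGamma_eq_zero_iff)
  define g where "g z = set_lebesgue_integral lborel {0<..<1} (hyp_integrand a q A B (a + q - A) z) / K" for z
  have "g holomorphic_on slit_plane"
    unfolding g_def using a b q \<open>K \<noteq> 0\<close>
    by (intro holomorphic_intros holomorphic_hyp_integral) (auto simp: AB)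
  moreover have "g z = hyp_series a b c z" if "z \<in> ball 0 1" for z
    using hyp_integral_eq_hyp_series[of a q A B "a + q - A" z] that a b q c \<open>K \<noteq> 0\<close>
    by (simp add: AB g_def K_def)
  ultimately show ?thesis unfolding has_slit_continuation_def by blast
qed

lemma plus_of_nat_not_nonpos_Ints:
  fixes c :: complex
  assumes "c \<notin> \<int>\<^sub>\<le>\<^sub>0"
  shows "c + of_nat n \<notin> \<int>\<^sub>\<le>\<^sub>0"
proof
  assume "c + of_nat n \<in> \<int>\<^sub>\<le>\<^sub>0"
  then obtain k where "c + of_nat n = - of_nat k" by (elim nonpos_Ints_cases')
  then have "c = - of_nat (k + n)" by (simp add: algebra_simps eq_neg_iff_add_eq_0)
  then show False using assms minus_of_nat_in_nonpos_Ints by metis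
qed

text \<open>Raising all three parameters by a large n makes Re a and Re b positive and keeps c off
  the nonpositive integers; n primitives then lead back down.\<close>

theorem has_slit_continuation:
  assumes c: "c \<notin> \<int>\<^sub>\<le>\<^sub>0"
  shows "has_slit_continuation a b c"
proof -
  obtain n where n: "real n > max (- Re a) (- Re b)" using reals_Archimedean2 by blast
  have "has_slit_continuation (a + of_nat n) (b + of_nat n) (c + of_nat n)"
    using n by (intro has_slit_continuation_Re_pos plus_of_nat_not_nonpos_Ints c) auto
  then show ?thesis by (rule has_slit_continuation_lower_iterate[OF c])
qed

text \<open>With existence known, the chosen function has both defining properties. From here on the
  definition of \<open>hyp2F1\<close> is opened only for its symmetry in a and b.\<close>

lemma
  assumes "c \<notin> \<int>\<^sub>\<le>\<^sub>0"
  shows holomorphic_hyp2F1: "hyp2F1 a b c holomorphic_on slit_plane"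
    and hyp2F1_eq_hyp_series: "norm z < 1 \<Longrightarrow> hyp2F1 a b c z = hyp_series a b c z"
proof -
  have "hyp2F1 a b c holomorphic_on slit_plane \<and> (\<forall>z\<in>ball 0 1. hyp2F1 a b c z = hyp_series a b c z)"
    unfolding hyp2F1_def
    by (rule someI_ex[OF has_slit_continuation[OF assms, unfolded has_slit_continuation_def]])
  then show "hyp2F1 a b c holomorphic_on slit_plane"
    "norm z < 1 \<Longrightarrow> hyp2F1 a b c z = hyp_series a b c z" by auto
qed

text \<open>Swapping a and b leaves the power series unchanged, so the choice operator is applied to
  the same predicate and the equality holds everywhere.\<close>

lemma hyp2F1_commute: "hyp2F1 a b c = hyp2F1 b a c"
proof -
  have "fps_hypergeo [a, b] [c] 1 = fps_hypergeo [b, a] [c] (1::complex)"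
    by (rule fps_ext) (simp add: mult.commute)
  then show ?thesis unfolding hyp2F1_def by simp
qed

text \<open>Both sides are holomorphic on the connected slit plane and agree on the unit disc by the
  series computation.\<close>

theorem hyp_integral:
  assumes "Re p > 0" "Re q > 0" "Re (p + q - A - B) > 0" and c: "p + q - B \<notin> \<int>\<^sub>\<le>\<^sub>0"
    and z: "z \<in> slit_plane"
  shows "set_lebesgue_integral lborel {0<..<1} (hyp_integrand p q A B (p + q - A) z) =
     Gamma p * Gamma q * Gamma (p + q - A - B) * rGamma (p + q - A) * rGamma (p + q - B) *
     hyp2F1 p (p + q - A - B) (p + q - B) z"
proof (rule analytic_continuation_open[OF _ open_slit_plane _ connected_slit_plane ball_subset_slit_plane _ _ _ z])
  show "(\<lambda>z. set_lebesgue_integral lborel {0<..<1} (hyp_integrand p q A B (p + q - A) z)) holomorphic_on slit_plane"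
    using assms by (intro holomorphic_hyp_integral) auto
  show "(\<lambda>z. Gamma p * Gamma q * Gamma (p + q - A - B) * rGamma (p + q - A) * rGamma (p + q - B) *
     hyp2F1 p (p + q - A - B) (p + q - B) z) holomorphic_on slit_plane"
    by (intro holomorphic_intros holomorphic_hyp2F1 c)
  show "set_lebesgue_integral lborel {0<..<1} (hyp_integrand p q A B (p + q - A) w) =
     Gamma p * Gamma q * Gamma (p + q - A - B) * rGamma (p + q - A) * rGamma (p + q - B) *
     hyp2F1 p (p + q - A - B) (p + q - B) w" if "w \<in> ball 0 1" for w
    using hyp_integral_eq_hyp_series[of p q A B "p + q - A" w] assms that by (simp add: hyp2F1_eq_hyp_series)
qed auto

subsection \<open>Pfaff's transformation\<close>

text \<open>The binomial series of (1 - z)^(-s), written with rising factorials so that no signs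
  occur.\<close>

definition fps_rising :: "complex \<Rightarrow> complex fps" where
  "fps_rising s = Abs_fps (\<lambda>n. pochhammer s n / fact n)"

lemma fps_rising_nth [simp]: "fps_nth (fps_rising s) n = pochhammer s n / fact n"
  by (simp add: fps_rising_def)

lemma has_fps_expansion_fps_rising:
  "(\<lambda>z. (1 - z) powr (- s)) has_fps_expansion fps_rising s"
proof -
  have "((\<lambda>x. (1 + x) powr (- s)) \<circ> (\<lambda>z. - z)) has_fps_expansion (fps_binomial (- s) oo (- fps_X))"
    by (intro fps_expansion_intros) auto
  moreover have "fps_binomial (- s) oo (- fps_X) = fps_rising s"
  proof (rule fps_ext)
    fix n
    have "fps_nth (fps_binomial (- s) oo (- fps_X)) n = (- 1) ^ n * (- s gchoose n)"
      using fps_nth_compose_linear[of "fps_binomial (- s)" "- 1" n]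
      by (simp add: fps_const_neg[symmetric] del: fps_const_neg)
    then show "fps_nth (fps_binomial (- s) oo (- fps_X)) n = fps_nth (fps_rising s) n"
      by (simp add: gbinomial_pochhammer flip: power_mult_distrib)
  qed
  ultimately show ?thesis by (simp add: comp_def)
qed

text \<open>The law of exponents for (1 - z)^(-s); on coefficients it is the binomial theorem for
  Pochhammer symbols.\<close>

lemma fps_rising_add: "fps_rising (s + t) = fps_rising s * fps_rising t"
proof (rule fps_ext)
  fix n
  have "of_nat (n choose k) * pochhammer s k * pochhammer t (n - k) / fact n =
        pochhammer s k / fact k * (pochhammer t (n - k) / fact (n - k))" if "k \<in> {0..n}" for k
    using that by (simp add: binomial_fact divide_simps)
  then show "fps_nth (fps_rising (s + t)) n = fps_nth (fps_rising s * fps_rising t) n"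
    by (simp add: fps_mult_nth pochhammer_binomial_sum sum_divide_distrib atMost_atLeast0)
qed

lemma fps_rising_1_power: "fps_rising 1 ^ k = fps_rising (of_nat k)"
proof (induction k)
  case 0
  show ?case by (rule fps_ext) (simp add: pochhammer_0_left)
qed (simp add: fps_rising_add)

text \<open>Because g has no constant term, its power g^i starts at order i. The inner sums can
  therefore all be extended to the common upper limit n and interchanged.\<close>

lemma fps_mult_compose_nth:
  fixes f g h :: "complex fps"
  assumes "fps_nth g 0 = 0"
  shows "fps_nth (h * (f oo g)) n = (\<Sum>i=0..n. fps_nth f i * fps_nth (h * g ^ i) n)"
proof -
  have "fps_nth (f oo g) m = (\<Sum>i=0..n. fps_nth f i * fps_nth (g ^ i) m)" if "m \<le> n" for m
    unfolding fps_compose_nth using that startsby_zero_power_prefix[OF assms]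
    by (intro sum.mono_neutral_left) auto
  then have "fps_nth (h * (f oo g)) n =
      (\<Sum>m=0..n. fps_nth h m * (\<Sum>i=0..n. fps_nth f i * fps_nth (g ^ i) (n - m)))"
    by (simp add: fps_mult_nth)
  also have "\<dots> = (\<Sum>i=0..n. \<Sum>m=0..n. fps_nth h m * (fps_nth f i * fps_nth (g ^ i) (n - m)))"
    unfolding sum_distrib_left by (rule sum.swap)
  also have "\<dots> = (\<Sum>i=0..n. fps_nth f i * fps_nth (h * g ^ i) n)"
    unfolding fps_mult_nth sum_distrib_left by (simp add: mult_ac)
  finally show ?thesis .
qed

lemma pochhammer_minus_of_nat:
  assumes "k \<le> n"
  shows "pochhammer (- of_nat n) k = ((- 1) ^ k * fact n / fact (n - k) :: complex)"
proof -
  have "of_nat (n choose k) = (- 1) ^ k * pochhammer (- of_nat n) k / (fact k :: complex)"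
    by (simp add: binomial_gbinomial gbinomial_pochhammer)
  then have "(- 1) ^ k * ((- 1) ^ k * pochhammer (- of_nat n) k) = (- 1) ^ k * (fact n / fact (n - k) :: complex)"
    using assms by (simp add: binomial_fact divide_simps)
  then show ?thesis by (simp flip: power_mult_distrib mult.assoc)
qed

text \<open>\<open>- fps_X * fps_rising 1\<close> is the expansion of z / (z - 1), and its powers
  times \<open>fps_rising a\<close> are again explicit. Comparing coefficients leaves a terminating
  sum, evaluated by the Chu-Vandermonde identity.\<close>

lemma Pfaff_fps:
  assumes c: "c \<notin> \<int>\<^sub>\<le>\<^sub>0"
  shows "fps_rising a * (fps_hypergeo [a, c - b] [c] 1 oo (- fps_X * fps_rising 1)) = fps_hypergeo [a, b] [c] 1"
proof (rule fps_ext)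
  fix n
  have g_power: "(- fps_X * fps_rising 1) ^ i = fps_const ((- 1) ^ i) * (fps_X ^ i * fps_rising (of_nat i))" for i
  proof -
    have "- fps_X * fps_rising 1 = fps_const (- 1) * (fps_X * fps_rising 1)" by (rule fps_ext) simp
    then show ?thesis by (simp only: power_mult_distrib fps_rising_1_power fps_const_power)
  qed
  have nth_term: "fps_nth (fps_rising a * (- fps_X * fps_rising 1) ^ i) n =
      (- 1) ^ i * pochhammer (a + of_nat i) (n - i) / fact (n - i)" if "i \<le> n" for i
  proof -
    have "fps_rising a * (- fps_X * fps_rising 1) ^ i = fps_const ((- 1) ^ i) * (fps_X ^ i * fps_rising (a + of_nat i))"
      unfolding g_power fps_rising_add by (simp only: mult_ac)
    then show ?thesis using that by (simp add: fps_X_power_mult_nth)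
  qed
  have "fps_nth (fps_rising a * (fps_hypergeo [a, c - b] [c] 1 oo (- fps_X * fps_rising 1))) n =
      (\<Sum>i=0..n. hyp_coeff a (c - b) c i * ((- 1) ^ i * pochhammer (a + of_nat i) (n - i) / fact (n - i)))"
    using nth_term by (subst fps_mult_compose_nth) (auto simp: fps_nth_hypergeo_2_1 simp del: fps_hypergeo_nth intro!: sum.cong)
  \<comment> \<open>Splitting (a)_n into (a)_i (a+i)_(n-i) removes a from the summand, and (-1)^i /
    (n-i)! becomes (-n)_i / n!, as Chu-Vandermonde requires.\<close>
  also have "\<dots> = (\<Sum>i=0..n. pochhammer a n / fact n *
      (pochhammer (c - b) i * pochhammer (- of_nat n) i / (of_nat (fact i) * pochhammer c i)))"
  proof (rule sum.cong)
    fix i assume "i \<in> {0..n}"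
    then have i: "i \<le> n" by simp
    have "pochhammer a n = pochhammer a i * pochhammer (a + of_nat i) (n - i)"
      using pochhammer_product[OF i] .
    then show "hyp_coeff a (c - b) c i * ((- 1) ^ i * pochhammer (a + of_nat i) (n - i) / fact (n - i)) =
      pochhammer a n / fact n * (pochhammer (c - b) i * pochhammer (- of_nat n) i / (of_nat (fact i) * pochhammer c i))"
      unfolding pochhammer_minus_of_nat[OF i] by (simp add: hyp_coeff_def mult_ac)
  qed simp
  also have "\<dots> = pochhammer a n / fact n * (pochhammer (c - (c - b)) n / pochhammer c n)"
    unfolding sum_distrib_left[symmetric]
    using c by (subst Vandermonde_pochhammer) (auto simp: minus_of_nat_in_nonpos_Ints)
  also have "\<dots> = fps_nth (fps_hypergeo [a, b] [c] 1) n"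
    unfolding fps_nth_hypergeo_2_1 by (simp add: hyp_coeff_def mult_ac)
  finally show "fps_nth (fps_rising a * (fps_hypergeo [a, c - b] [c] 1 oo (- fps_X * fps_rising 1))) n =
      fps_nth (fps_hypergeo [a, b] [c] 1) n" .
qed

text \<open>The map z / (z - 1) is its own inverse: a value x >= 1 would force z = x / (x - 1),
  again a real number >= 1, while the value x = 1 is never attained.\<close>

lemma slit_plane_Pfaff:
  assumes "z \<in> slit_plane"
  shows "z / (z - 1) \<in> slit_plane"
proof
  assume "z / (z - 1) \<in> complex_of_real ` {1..}"
  then obtain x where x: "x \<ge> 1" "z / (z - 1) = complex_of_real x" by auto
  have z1: "z \<noteq> 1" using assms unfolding slit_plane_iff by auto
  then have z_eq: "z = of_real x * (z - 1)" using x(2) by (simp add: field_simps)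
  then have x1: "x \<noteq> 1" by auto
  have "z * (of_real x - 1) = of_real x" using z_eq by (simp add: algebra_simps)
  then have "z = of_real (x / (x - 1))" using x1 by (simp add: field_simps)
  moreover have "x / (x - 1) \<ge> 1" using x(1) x1 by (simp add: le_divide_eq)
  ultimately show False using assms by (metis ComplD atLeast_iff image_eqI)
qed

text \<open>The formal identity gives equality near 0, and the identity theorem spreads it over the
  slit plane, which the map z / (z - 1) sends into itself.\<close>

theorem Pfaff_transformation:
  assumes c: "c \<notin> \<int>\<^sub>\<le>\<^sub>0" and z: "z \<in> slit_plane"
  shows "hyp2F1 a b c z = (1 - z) powr (- a) * hyp2F1 a (c - b) c (z / (z - 1))"
proof -
  have hol: "(\<lambda>z. (1 - z) powr (- a) * hyp2F1 a (c - b) c (z / (z - 1))) holomorphic_on slit_plane"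
  proof -
    have "z - 1 \<noteq> 0" if "z \<in> slit_plane" for z
      using that unfolding slit_plane_iff by auto
    then have "(\<lambda>z. z / (z - 1)) holomorphic_on slit_plane" by (intro holomorphic_intros) auto
    then have "hyp2F1 a (c - b) c \<circ> (\<lambda>z. z / (z - 1)) holomorphic_on slit_plane"
      by (rule holomorphic_on_compose_gen[OF _ holomorphic_hyp2F1[OF c]])
        (rule image_subsetI, rule slit_plane_Pfaff)
    then show ?thesis
      unfolding comp_def using one_minus_slit_plane by (intro holomorphic_intros) auto
  qed
  have "((\<lambda>z. (1 - z) powr (- a) * (hyp_series a (c - b) c \<circ> (\<lambda>z. - z * (1 - z) powr (- 1))) z)
      has_fps_expansion fps_rising a * (fps_hypergeo [a, c - b] [c] 1 oo (- fps_X * fps_rising 1)))"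
    by (intro fps_expansion_intros has_fps_expansion_fps_rising has_fps_expansion_hyp_series c) auto
  then have "\<forall>\<^sub>F z in nhds 0. hyp_series a b c z =
      (1 - z) powr (- a) * hyp_series a (c - b) c (- z * (1 - z) powr (- 1))"
    unfolding Pfaff_fps[OF c] by (simp add: has_fps_expansion_def comp_def)
  \<comment> \<open>For |z| < 1/2 one has |z| < |z - 1|, so z and z / (z - 1) both lie in the unit
    disc, where \<open>hyp2F1\<close> equals its series.\<close>
  moreover have "\<forall>\<^sub>F z in nhds 0. z \<in> ball (0::complex) (1/2)"
    by (intro eventually_nhds_in_open) auto
  ultimately have "\<forall>\<^sub>F z in nhds 0. hyp2F1 a b c z = (1 - z) powr (- a) * hyp2F1 a (c - b) c (z / (z - 1))"
  proof eventually_elim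
    case (elim z)
    have z: "norm z < 1/2" using elim by simp
    have "norm (1 - z) \<ge> 1 - norm z" using norm_triangle_ineq2[of 1 z] by simp
    then have lt: "norm z < norm (z - 1)" using z by (simp add: norm_minus_commute)
    then have "z \<noteq> 1" by auto
    then have "- z * (1 - z) powr (- 1) = z / (z - 1)"
      by (simp add: powr_minus_divide divide_simps) (simp add: algebra_simps)
    moreover have "norm (z / (z - 1)) < 1"
      using lt by (simp add: norm_divide divide_less_eq)
    ultimately show ?case
      using elim z by (simp add: hyp2F1_eq_hyp_series[OF c])
  qed
  then obtain U where "open U" "0 \<in> U"
    and U: "\<And>z. z \<in> U \<Longrightarrow> hyp2F1 a b c z = (1 - z) powr (- a) * hyp2F1 a (c - b) c (z / (z - 1))"
    unfolding eventually_nhds by blast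
  show ?thesis
  proof (rule analytic_continuation_open[where s = "U \<inter> slit_plane" and s' = slit_plane and z = z
        and f = "hyp2F1 a b c" and g = "\<lambda>z. (1 - z) powr (- a) * hyp2F1 a (c - b) c (z / (z - 1))"])
    show "open (U \<inter> slit_plane)" using \<open>open U\<close> open_slit_plane by (rule open_Int)
    have "0 \<in> U \<inter> slit_plane" using \<open>0 \<in> U\<close> ball_subset_slit_plane by auto
    then show "U \<inter> slit_plane \<noteq> {}" by blast
  qed (use hol holomorphic_hyp2F1[OF c] open_slit_plane connected_slit_plane U z in auto)
qed

subsection \<open>The integral identities\<close>

lemma has_set_integral_cong:
  assumes "\<And>y. y \<in> S \<Longrightarrow> f y = g y" "has_set_integral f S v" "v = w"
  shows "has_set_integral g S w"
proof -
  have "(\<lambda>y. indicator S y *\<^sub>R f y) = (\<lambda>y. indicator S y *\<^sub>R g y)"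
    using assms(1) by (auto simp: indicator_def fun_eq_iff)
  then show ?thesis
    using assms(2,3)
    unfolding has_set_integral_def set_integrable_def set_lebesgue_integral_def by simp
qed

lemma has_set_integral_mult_right:
  "has_set_integral f S v \<Longrightarrow> has_set_integral (\<lambda>y. k * f y) S (k * v)"
  unfolding has_set_integral_def by simp

lemma has_set_integral_hyp_integrand:
  assumes "Re p > 0" "Re q > 0" "Re (p + q - A - B) > 0" "p + q - B \<notin> \<int>\<^sub>\<le>\<^sub>0" "z \<in> slit_plane"
  shows "has_set_integral (hyp_integrand p q A B (p + q - A) z) {0<..<1}
     (Gamma p * Gamma q * Gamma (p + q - A - B) * rGamma (p + q - A) * rGamma (p + q - B) *
      hyp2F1 p (p + q - A - B) (p + q - B) z)"
  unfolding has_set_integral_def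
  using set_integrable_hyp_integrand[OF assms(1-3,5)] hyp_integral[OF assms] by simp

text \<open>The substitution takes place for absolute integrability with respect to the completed
  measure. Continuity of f supplies the Borel measurability needed to return to
  \<open>lborel\<close>.\<close>

lemma has_set_integral_change_of_variables:
  fixes f :: "real \<Rightarrow> complex"
  assumes S: "S \<in> sets borel" and T: "T \<in> sets borel" "g ` S = T"
    and f: "continuous_on T f"
    and g: "\<And>s. s \<in> S \<Longrightarrow> (g has_field_derivative h s) (at s within S)" "inj_on g S"
    and int: "has_set_integral (\<lambda>s. \<bar>h s\<bar> *\<^sub>R f (g s)) S v"
  shows "has_set_integral f T v"
proof -
  have "set_integrable lborel S (\<lambda>s. \<bar>h s\<bar> *\<^sub>R f (g s))"
    and "set_lebesgue_integral lborel S (\<lambda>s. \<bar>h s\<bar> *\<^sub>R f (g s)) = v"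
    using int unfolding has_set_integral_def by auto
  then have "(\<lambda>s. \<bar>h s\<bar> *\<^sub>R f (g s)) absolutely_integrable_on S \<and> integral S (\<lambda>s. \<bar>h s\<bar> *\<^sub>R f (g s)) = v"
    using set_borel_integral_eq_integral(2)[of S "\<lambda>s. \<bar>h s\<bar> *\<^sub>R f (g s)"]
    by (auto simp: set_integrable_def intro: integrable_completion[THEN iffD2])
  then have abs_int: "f absolutely_integrable_on T" and I: "integral T f = v"
    using has_absolute_integral_change_of_variables_real[OF _ g, of f v] S T(2) by auto
  have "(\<lambda>y. indicator T y *\<^sub>R f y) \<in> borel_measurable lborel"
    using set_borel_measurable_lborel_continuous[OF f T(1)] by (simp add: set_borel_measurable_def)
  then have "set_integrable lborel T f"
    using abs_int by (simp add: set_integrable_def integrable_completion)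
  then show ?thesis
    using I set_borel_integral_eq_integral(2) unfolding has_set_integral_def by metis
qed

lemma of_real_powr_eq_exp: "x > 0 \<Longrightarrow> complex_of_real x powr s = exp (s * of_real (ln x))"
  by (simp add: powr_def Ln_of_real)

lemma of_real_powr_mult:
  "x > 0 \<Longrightarrow> y > 0 \<Longrightarrow> complex_of_real (x * y) powr s = of_real x powr s * of_real y powr s"
  by (simp add: powr_times_real)

lemma of_real_slit_plane: "x < 1 \<Longrightarrow> complex_of_real x \<in> slit_plane"
  unfolding slit_plane_iff by simp

text \<open>The integral formula with p = a - \<mu>, q = c - a - b + 1, A = c - b, B = c - a and z =
  1/x. Here p + q - A = 1 - \<mu>, which matches |x - y| = |x| (1 - y/x) raised to \<mu> -
  1.\<close>

theorem w6_integral: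
  fixes a b c \<mu> :: complex and x :: real
  assumes "Re (a - c - \<mu> + 1) > 0" "Re (a - \<mu>) > 0" "Re (c - a - b + 1) > 0"
    and C: "(a - \<mu>) - b + 1 \<notin> \<int>\<^sub>\<le>\<^sub>0" and x: "x \<in> {..<0} \<union> {1<..}"
  shows "has_set_integral
     (\<lambda>y. complex_of_real y powr (a - \<mu> - 1) * w6 y a b c * complex_of_real \<bar>x - y\<bar> powr (\<mu> - 1)) {0<..<1}
     (Gamma (a - c - \<mu> + 1) * Gamma (a - \<mu>) * Gamma (c - a - b + 1) *
      rGamma (a - b - \<mu> + 1) * rGamma (1 - \<mu>) * complex_of_real \<bar>x\<bar> powr (a - 1) * w3 x (a - \<mu>) b c)"
proof -
  define p q A B where "p = a - \<mu>" and "q = c - a - b + 1" and "A = c - b" and "B = c - a"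
  have eqs: "p + q - A = 1 - \<mu>" "p + q - B = a - \<mu> - b + 1" "1 - \<mu> - B = a - \<mu> - c + 1"
    by (simp_all add: p_def q_def A_def B_def)
  have q: "Re q > 0" using assms by (simp add: q_def)
  have pos: "Re p > 0" "Re (p + q - A - B) > 0" "p + q - B \<notin> \<int>\<^sub>\<le>\<^sub>0"
    using assms unfolding eqs by (simp_all add: p_def)
  have x0: "x \<noteq> 0" using x by auto
  have ix: "inverse x < 1" using x by (auto simp: inverse_less_1_iff)
  have "has_set_integral (hyp_integrand p q A B (p + q - A) (complex_of_real (inverse x))) {0<..<1}
     (Gamma p * Gamma q * Gamma (p + q - A - B) * rGamma (p + q - A) * rGamma (p + q - B) *
      hyp2F1 p (p + q - A - B) (p + q - B) (complex_of_real (inverse x)))"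
    by (intro has_set_integral_hyp_integrand of_real_slit_plane ix q pos)
  \<comment> \<open>The factor |x|^(\<mu>-1) is split off from |x - y|^(\<mu>-1). On the right-hand
    side it is |x|^(a-1) times the power |x|^(-(a-\<mu>)) contained in \<open>w3\<close>.\<close>
  from has_set_integral_mult_right[OF this, of "complex_of_real \<bar>x\<bar> powr (\<mu> - 1)"]
  show ?thesis
  proof (rule has_set_integral_cong[rotated])
    fix y :: real assume "y \<in> {0<..<1}"
    then have y: "0 < y" "y < 1" by auto
    have w: "1 - inverse x * y > 0"
    proof (cases "x < 0")
      case True
      then have "inverse x * y \<le> 0" using y by (simp add: mult_nonpos_nonneg)
      then show ?thesis by simp
    next
      case False
      then have "x > 1" using x by auto
      then show ?thesis using y by (simp add: field_simps)
    qed
    have "x - y = x * (1 - inverse x * y)" using x0 by (simp add: field_simps)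
    then have "\<bar>x - y\<bar> = \<bar>x * (1 - inverse x * y)\<bar>" by simp
    also have "\<dots> = \<bar>x\<bar> * (1 - inverse x * y)" using w by (simp add: abs_mult)
    finally have xy: "complex_of_real \<bar>x - y\<bar> powr (\<mu> - 1) =
        of_real \<bar>x\<bar> powr (\<mu> - 1) * of_real (1 - inverse x * y) powr (\<mu> - 1)"
      using x0 w of_real_powr_mult[of "\<bar>x\<bar>" "1 - inverse x * y"] by simp
    have "norm (complex_of_real (1 - y)) < 1" using y unfolding norm_of_real by simp
    then have "hyp2F1 (c - a) (c - b) q (complex_of_real (1 - y)) = hyp_series A B q (of_real (1 - y))"
      unfolding A_def B_def hyp2F1_commute[of "c - a"]
      by (rule hyp2F1_eq_hyp_series[OF Re_pos_not_nonpos_Ints[OF q]])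
    then have "w6 y a b c = of_real (1 - y) powr (q - 1) * hyp_series A B q (of_real (1 - y))"
      using y by (simp add: w6_def q_def)
    moreover have "(1 - complex_of_real (inverse x) * complex_of_real y) powr (- (p + q - A)) =
        of_real (1 - inverse x * y) powr (\<mu> - 1)"
      unfolding eqs by simp
    ultimately show "complex_of_real \<bar>x\<bar> powr (\<mu> - 1) * hyp_integrand p q A B (p + q - A) (complex_of_real (inverse x)) y =
       complex_of_real y powr (a - \<mu> - 1) * w6 y a b c * complex_of_real \<bar>x - y\<bar> powr (\<mu> - 1)"
      unfolding xy hyp_integrand_def hyp_kernel_def p_def[symmetric] by (simp only: mult_ac)
  next
    have "complex_of_real \<bar>x\<bar> powr (a - 1) * of_real \<bar>x\<bar> powr (- (a - \<mu>)) = of_real \<bar>x\<bar> powr (\<mu> - 1)"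
      by (simp flip: powr_add)
    then show "complex_of_real \<bar>x\<bar> powr (\<mu> - 1) * (Gamma p * Gamma q * Gamma (p + q - A - B) *
        rGamma (p + q - A) * rGamma (p + q - B) * hyp2F1 p (p + q - A - B) (p + q - B) (complex_of_real (inverse x))) =
      Gamma (a - c - \<mu> + 1) * Gamma (a - \<mu>) * Gamma (c - a - b + 1) *
      rGamma (a - b - \<mu> + 1) * rGamma (1 - \<mu>) * complex_of_real \<bar>x\<bar> powr (a - 1) * w3 x (a - \<mu>) b c"
      unfolding w3_def eqs by (simp add: p_def q_def algebra_simps)
  qed
qed

text \<open>For y = -s / (1 - s) one has 1/y = 1 - 1/s, which Pfaff's transformation sends to 1 - s,
  inside the unit disc. The prefactors have bases s / (1 - s) and 1/s, so the powers of s
  cancel.\<close>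

lemma w4_eq_hyp_series:
  assumes q: "b - a + 1 \<notin> \<int>\<^sub>\<le>\<^sub>0" and s: "0 < s" "s < 1"
  shows "w4 (- s / (1 - s)) a b c =
     complex_of_real (1 - s) powr b * hyp_series b (c - a) (b - a + 1) (of_real (1 - s))"
proof -
  define y where "y = - s / (1 - s)"
  have y: "y < 0" using s by (simp add: y_def divide_neg_pos)
  then have iy: "inverse y < 1" by (meson less_trans negative_imp_inverse_negative zero_less_one)
  have iy_eq: "inverse y = 1 - inverse s" using s by (simp add: y_def field_simps)
  have "hyp2F1 b (b - c + 1) (b - a + 1) (complex_of_real (inverse y)) =
      (1 - complex_of_real (inverse y)) powr (- b) *
      hyp2F1 b (b - a + 1 - (b - c + 1)) (b - a + 1) (complex_of_real (inverse y) / (complex_of_real (inverse y) - 1))"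
    by (intro Pfaff_transformation q of_real_slit_plane iy)
  also have "complex_of_real (inverse y) / (complex_of_real (inverse y) - 1) = complex_of_real (1 - s)"
    using s unfolding iy_eq by (simp add: field_simps)
  also have "1 - complex_of_real (inverse y) = complex_of_real (inverse s)"
    unfolding iy_eq by simp
  also have "b - a + 1 - (b - c + 1) = c - a" by simp
  also have "hyp2F1 b (c - a) (b - a + 1) (complex_of_real (1 - s)) = hyp_series b (c - a) (b - a + 1) (of_real (1 - s))"
  proof (rule hyp2F1_eq_hyp_series[OF q])
    show "norm (complex_of_real (1 - s)) < 1" using s unfolding norm_of_real by simp
  qed
  finally have "w4 y a b c = of_real (s / (1 - s)) powr (- b) * of_real (inverse s) powr (- b) *
      hyp_series b (c - a) (b - a + 1) (of_real (1 - s))"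
    using s by (simp add: w4_def y_def)
  also have "complex_of_real (s / (1 - s)) powr (- b) * of_real (inverse s) powr (- b) = of_real (inverse (1 - s)) powr (- b)"
    using s by (subst of_real_powr_mult[symmetric]) (auto simp: field_simps)
  also have "\<dots> = of_real (1 - s) powr b"
    using s by (simp only: of_real_powr_eq_exp positive_imp_inverse_positive diff_gt_0_iff_gt ln_inverse) simp
  finally show ?thesis by (simp only: y_def)
qed

lemma image_minus_odds: "(\<lambda>s::real. - s / (1 - s)) ` {0<..<1} = {..<0}"
proof
  show "(\<lambda>s::real. - s / (1 - s)) ` {0<..<1} \<subseteq> {..<0}" by (auto simp: divide_neg_pos)
  show "{..<0} \<subseteq> (\<lambda>s::real. - s / (1 - s)) ` {0<..<1}"
  proof
    fix y :: real assume "y \<in> {..<0}"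
    then have y: "y < 0" by simp
    have "y = - (y / (y - 1)) / (1 - y / (y - 1))" using y by (simp add: divide_simps)
    moreover have "y / (y - 1) \<in> {0<..<1}" using y by (simp add: zero_less_divide_iff divide_less_eq)
    ultimately show "y \<in> (\<lambda>s::real. - s / (1 - s)) ` {0<..<1}" by (rule image_eqI)
  qed
qed

lemma has_field_derivative_minus_odds:
  "s < 1 \<Longrightarrow> ((\<lambda>s::real. - s / (1 - s)) has_field_derivative - 1 / (1 - s)\<^sup>2) (at s within S)"
  by (rule derivative_eq_intros refl | simp add: power2_eq_square)+

lemma inj_on_minus_odds: "inj_on (\<lambda>s::real. - s / (1 - s)) {0<..<1}"
  by (rule inj_onI) (auto simp: divide_simps algebra_simps)

text \<open>Provides the continuity of the integrand that the change of variables asks for.\<close>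

lemma continuous_on_w4:
  assumes "b - a + 1 \<notin> \<int>\<^sub>\<le>\<^sub>0"
  shows "continuous_on {..<0} (\<lambda>y. w4 y a b c)"
proof -
  have "continuous_on {..<0} (\<lambda>y. hyp2F1 b (b - c + 1) (b - a + 1) (complex_of_real (inverse y)))"
  proof (rule continuous_on_compose2[OF holomorphic_on_imp_continuous_on[OF holomorphic_hyp2F1[OF assms]]])
    show "continuous_on {..<0} (\<lambda>y::real. complex_of_real (inverse y))"
      by (intro continuous_intros) auto
    have "inverse y < 1" if "y < 0" for y :: real
      using that by (meson less_trans negative_imp_inverse_negative zero_less_one)
    then show "(\<lambda>y. complex_of_real (inverse y)) ` {..<0} \<subseteq> slit_plane"
      by (intro image_subsetI of_real_slit_plane) simp
  qed
  then show ?thesis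
    unfolding w4_def by (intro continuous_on_mult continuous_on_of_real_powr continuous_intros) auto
qed

text \<open>Under y = -s / (1 - s) one has x - y = x (1 - z s) / (1 - s) with z = 1 - 1/x. The
  integral formula applies with p = a - \<mu>, q = b - a + 1, A = b and B = c - a.\<close>

theorem w4_integral:
  fixes a b c \<mu> :: complex and x :: real
  assumes "Re (a - \<mu>) > 0" "Re (a - c - \<mu> + 1) > 0" "Re (b - a + 1) > 0"
    and C: "(a - \<mu>) + b - c + 1 \<notin> \<int>\<^sub>\<le>\<^sub>0" and x: "x > 0"
  shows "has_set_integral
     (\<lambda>y. complex_of_real (- y) powr (a - \<mu> - 1) * w4 y a b c * complex_of_real (x - y) powr (\<mu> - 1)) {..<0}
     (Gamma (a - \<mu>) * Gamma (a - c - \<mu> + 1) * Gamma (b - a + 1) *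
      rGamma (a + b - c - \<mu> + 1) * rGamma (1 - \<mu>) * complex_of_real x powr (a - 1) * w5 x (a - \<mu>) b c)"
    (is "has_set_integral ?f _ ?v")
proof -
  define p q A B where "p = a - \<mu>" and "q = b - a + 1" and "A = b" and "B = c - a"
  have eqs: "p + q - A = 1 - \<mu>" "p + q - B = a - \<mu> + b - c + 1" "1 - \<mu> - B = a - \<mu> - c + 1"
    by (simp_all add: p_def q_def A_def B_def)
  have q: "Re q > 0" using assms by (simp add: q_def)
  have pos: "Re p > 0" "Re (p + q - A - B) > 0" "p + q - B \<notin> \<int>\<^sub>\<le>\<^sub>0"
    using assms unfolding eqs by (simp_all add: p_def)
  have q': "b - a + 1 \<notin> \<int>\<^sub>\<le>\<^sub>0" using q unfolding q_def by (rule Re_pos_not_nonpos_Ints)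
  define z where "z = 1 - inverse x"
  have z: "z < 1" using x by (simp add: z_def)
  have int: "has_set_integral (\<lambda>s. complex_of_real x powr (\<mu> - 1) * hyp_integrand p q A B (p + q - A) (complex_of_real z) s) {0<..<1}
     (complex_of_real x powr (\<mu> - 1) * (Gamma p * Gamma q * Gamma (p + q - A - B) * rGamma (p + q - A) * rGamma (p + q - B) *
      hyp2F1 p (p + q - A - B) (p + q - B) (complex_of_real z)))"
    by (intro has_set_integral_mult_right has_set_integral_hyp_integrand of_real_slit_plane z q pos)
  define g h where "g s = - s / (1 - s)" and "h s = - 1 / (1 - s)\<^sup>2" for s :: real
  have integrand: "complex_of_real x powr (\<mu> - 1) * hyp_integrand p q A B (p + q - A) (complex_of_real z) s =
      \<bar>h s\<bar> *\<^sub>R ?f (g s)" if "s \<in> {0<..<1}" for s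
  proof -
    have s: "0 < s" "s < 1" using that by auto
    have w: "1 - z * s > 0"
    proof -
      have "1 - z * s = (1 - s) + inverse x * s" by (simp add: z_def algebra_simps)
      also have "\<dots> > 0" using s x by (intro add_pos_pos mult_pos_pos) auto
      finally show ?thesis .
    qed
    have w4: "w4 (g s) a b c = of_real (1 - s) powr b * hyp_series A B q (of_real (1 - s))"
      unfolding g_def A_def B_def q_def by (rule w4_eq_hyp_series[OF q' s])
    have "x - g s = x * (1 - z * s) / (1 - s)"
      using s x by (simp add: g_def z_def field_simps)
    then have ln_xy: "ln (x - g s) = ln x + ln (1 - z * s) - ln (1 - s)" and xy: "x - g s > 0"
      using s x w by (simp_all add: ln_div ln_mult)
    have gs: "- g s > 0" and ln_g: "ln (- g s) = ln s - ln (1 - s)" using s by (simp_all add: g_def ln_div)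
    have "(1 - s)\<^sup>2 = exp (2 * ln (1 - s))" using s by (simp add: exp_double)
    then have "\<bar>h s\<bar> = exp (- 2 * ln (1 - s))"
      by (simp add: h_def exp_minus inverse_eq_divide)
    then have h: "complex_of_real \<bar>h s\<bar> = exp (- 2 * of_real (ln (1 - s)))"
      by (simp flip: exp_of_real)
    \<comment> \<open>All bases are positive, so the powers become exponentials of logarithms and
      the identity is linear in these. The exponents of 1 - s, including -2 from the Jacobian, sum
      to -2 - (a-\<mu>-1) + b - (\<mu>-1) = b - a = q - 1.\<close>
    have "exp (- 2 * of_real (ln (1 - s))) * (exp ((a - \<mu> - 1) * of_real (ln s - ln (1 - s))) *
        exp (b * of_real (ln (1 - s))) * exp ((\<mu> - 1) * of_real (ln x + ln (1 - z * s) - ln (1 - s)))) =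
      exp ((\<mu> - 1) * complex_of_real (ln x)) * (exp ((p - 1) * of_real (ln s)) * exp ((q - 1) * of_real (ln (1 - s))) *
        exp ((\<mu> - 1) * of_real (ln (1 - z * s))))"
      unfolding exp_add[symmetric] p_def q_def by (simp add: algebra_simps)
    then have powrs: "complex_of_real \<bar>h s\<bar> * (of_real (- g s) powr (a - \<mu> - 1) * of_real (1 - s) powr b *
        of_real (x - g s) powr (\<mu> - 1)) =
      of_real x powr (\<mu> - 1) * (of_real s powr (p - 1) * of_real (1 - s) powr (q - 1) * of_real (1 - z * s) powr (\<mu> - 1))"
      using s x w xy gs unfolding h by (simp only: of_real_powr_eq_exp ln_xy ln_g diff_gt_0_iff_gt)
    have "of_real \<bar>h s\<bar> * ?f (g s) = complex_of_real \<bar>h s\<bar> * (of_real (- g s) powr (a - \<mu> - 1) *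
        of_real (1 - s) powr b * of_real (x - g s) powr (\<mu> - 1)) * hyp_series A B q (of_real (1 - s))"
      unfolding w4 by (simp only: mult_ac)
    also have "\<dots> = of_real x powr (\<mu> - 1) * (of_real s powr (p - 1) * of_real (1 - s) powr (q - 1) *
        hyp_series A B q (of_real (1 - s)) * of_real (1 - z * s) powr (\<mu> - 1))"
      unfolding powrs by (simp only: mult_ac)
    also have "\<dots> = of_real x powr (\<mu> - 1) * hyp_integrand p q A B (p + q - A) (of_real z) s"
      unfolding hyp_integrand_def hyp_kernel_def eqs by simp
    finally show ?thesis unfolding scaleR_conv_of_real by simp
  qed
  have int': "has_set_integral (\<lambda>s. \<bar>h s\<bar> *\<^sub>R ?f (g s)) {0<..<1} ?v"
  proof (rule has_set_integral_cong[OF integrand int])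
    \<comment> \<open>Pfaff's transformation carries the argument 1 - x of \<open>w5\<close> to 1 -
      1/x = z, with prefactor x^(-(a-\<mu>)).\<close>
    have "w5 x (a - \<mu>) b c = of_real x powr (- (a - \<mu>)) * hyp2F1 p (p + q - A - B) (p + q - B) (complex_of_real z)"
    proof -
      have "w5 x (a - \<mu>) b c = (1 - complex_of_real (1 - x)) powr (- (a - \<mu>)) *
          hyp2F1 (a - \<mu>) (a - \<mu> + b - c + 1 - b) (a - \<mu> + b - c + 1) (complex_of_real (1 - x) / (complex_of_real (1 - x) - 1))"
        unfolding w5_def using x C by (intro Pfaff_transformation of_real_slit_plane) auto
      also have "complex_of_real (1 - x) / (complex_of_real (1 - x) - 1) = complex_of_real z"
        using x by (simp add: z_def field_simps)
      finally show ?thesis unfolding eqs by (simp add: p_def algebra_simps)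
    qed
    moreover have "complex_of_real x powr (a - 1) * of_real x powr (- (a - \<mu>)) = of_real x powr (\<mu> - 1)"
      by (simp flip: powr_add)
    ultimately show "complex_of_real x powr (\<mu> - 1) * (Gamma p * Gamma q * Gamma (p + q - A - B) * rGamma (p + q - A) *
        rGamma (p + q - B) * hyp2F1 p (p + q - A - B) (p + q - B) (complex_of_real z)) = ?v"
      unfolding eqs by (simp add: p_def q_def algebra_simps)
  qed simp_all
  have cont: "continuous_on {..<0} ?f"
    using x by (intro continuous_on_mult continuous_on_of_real_powr continuous_on_w4 q' continuous_intros) auto
  show ?thesis
    by (rule has_set_integral_change_of_variables[OF _ _ image_minus_odds cont
        has_field_derivative_minus_odds inj_on_minus_odds int'[unfolded g_def h_def]]) simp_all
qed

section \<open>Symmetry under exchange of a and b\<close>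

lemma w4_swap: "w4 x b a c = w3 x a b c"
  by (simp add: w3_def w4_def)

lemma w5_swap: "w5 x a b c = w5 x b a c"
  by (simp add: w5_def hyp2F1_commute[of a] add.commute[of a])

lemma w6_swap: "w6 x a b c = w6 x b a c"
  by (simp add: w6_def hyp2F1_commute[of "c - a"] cancel_ab_semigroup_add_class.diff_right_commute[of c a])

theorem mainTheorem12:
  fixes a b c \<mu> :: complex
  shows "((Re (a - \<mu>) > 0 \<and> Re (a - c - \<mu> + 1) > 0 \<and> Re (b - a + 1) > 0 \<and>
       b - a + 1 \<notin> \<int>\<^sub>\<le>\<^sub>0 \<and>
       (a - \<mu>) + b - c + 1 \<notin> \<int>\<^sub>\<le>\<^sub>0)
      \<longrightarrow> (\<forall>x\<in>{0<..<1} \<union> {1<..}.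
        has_set_integral
          (\<lambda>y. complex_of_real (- y) powr (a - \<mu> - 1) * w4 y a b c * complex_of_real (x - y) powr (\<mu> - 1))
          {..<0}
          (Gamma (a - \<mu>) * Gamma (a - c - \<mu> + 1) * Gamma (b - a + 1) *
           rGamma (a + b - c - \<mu> + 1) * rGamma (1 - \<mu>) *
           complex_of_real x powr (a - 1) * w5 x (a - \<mu>) b c)))
    \<and> ((Re (a - c - \<mu> + 1) > 0 \<and> Re (a - \<mu>) > 0 \<and> Re (c - a - b + 1) > 0 \<and>
       c - a - b + 1 \<notin> \<int>\<^sub>\<le>\<^sub>0 \<and>
       (a - \<mu>) - b + 1 \<notin> \<int>\<^sub>\<le>\<^sub>0)
      \<longrightarrow> (\<forall>x\<in>{..<0} \<union> {1<..}.
        has_set_integral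
          (\<lambda>y. complex_of_real y powr (a - \<mu> - 1) * w6 y a b c * complex_of_real \<bar>x - y\<bar> powr (\<mu> - 1))
          {0<..<1}
          (Gamma (a - c - \<mu> + 1) * Gamma (a - \<mu>) * Gamma (c - a - b + 1) *
           rGamma (a - b - \<mu> + 1) * rGamma (1 - \<mu>) *
           complex_of_real \<bar>x\<bar> powr (a - 1) * w3 x (a - \<mu>) b c)))
    \<and> ((Re (b - \<mu>) > 0 \<and> Re (b - c - \<mu> + 1) > 0 \<and> Re (a - b + 1) > 0 \<and>
       a - b + 1 \<notin> \<int>\<^sub>\<le>\<^sub>0 \<and>
       a + (b - \<mu>) - c + 1 \<notin> \<int>\<^sub>\<le>\<^sub>0)
      \<longrightarrow> (\<forall>x\<in>{0<..<1} \<union> {1<..}.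
        has_set_integral
          (\<lambda>y. complex_of_real (- y) powr (b - \<mu> - 1) * w3 y a b c * complex_of_real (x - y) powr (\<mu> - 1))
          {..<0}
          (Gamma (b - \<mu>) * Gamma (b - c - \<mu> + 1) * Gamma (a - b + 1) *
           rGamma (a + b - c - \<mu> + 1) * rGamma (1 - \<mu>) *
           complex_of_real x powr (b - 1) * w5 x a (b - \<mu>) c)))
    \<and> ((Re (b - c - \<mu> + 1) > 0 \<and> Re (b - \<mu>) > 0 \<and> Re (c - a - b + 1) > 0 \<and>
       c - a - b + 1 \<notin> \<int>\<^sub>\<le>\<^sub>0 \<and>
       (b - \<mu>) - a + 1 \<notin> \<int>\<^sub>\<le>\<^sub>0)
      \<longrightarrow> (\<forall>x\<in>{..<0} \<union> {1<..}.
        has_set_integral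
          (\<lambda>y. complex_of_real y powr (b - \<mu> - 1) * w6 y a b c * complex_of_real \<bar>x - y\<bar> powr (\<mu> - 1))
          {0<..<1}
          (Gamma (b - c - \<mu> + 1) * Gamma (b - \<mu>) * Gamma (c - a - b + 1) *
           rGamma (b - a - \<mu> + 1) * rGamma (1 - \<mu>) *
           complex_of_real \<bar>x\<bar> powr (b - 1) * w4 x a (b - \<mu>) c)))"
proof (intro conjI impI ballI; elim conjE)
  fix x :: real
  assume "Re (a - \<mu>) > 0" "Re (a - c - \<mu> + 1) > 0" "Re (b - a + 1) > 0"
    "(a - \<mu>) + b - c + 1 \<notin> \<int>\<^sub>\<le>\<^sub>0" "x \<in> {0<..<1} \<union> {1<..}"
  then show "has_set_integral
      (\<lambda>y. complex_of_real (- y) powr (a - \<mu> - 1) * w4 y a b c * complex_of_real (x - y) powr (\<mu> - 1)) {..<0}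
      (Gamma (a - \<mu>) * Gamma (a - c - \<mu> + 1) * Gamma (b - a + 1) * rGamma (a + b - c - \<mu> + 1) * rGamma (1 - \<mu>) *
       complex_of_real x powr (a - 1) * w5 x (a - \<mu>) b c)"
    by (intro w4_integral) auto
next
  fix x :: real
  assume "Re (a - c - \<mu> + 1) > 0" "Re (a - \<mu>) > 0" "Re (c - a - b + 1) > 0"
    "(a - \<mu>) - b + 1 \<notin> \<int>\<^sub>\<le>\<^sub>0" "x \<in> {..<0} \<union> {1<..}"
  then show "has_set_integral
      (\<lambda>y. complex_of_real y powr (a - \<mu> - 1) * w6 y a b c * complex_of_real \<bar>x - y\<bar> powr (\<mu> - 1)) {0<..<1}
      (Gamma (a - c - \<mu> + 1) * Gamma (a - \<mu>) * Gamma (c - a - b + 1) * rGamma (a - b - \<mu> + 1) * rGamma (1 - \<mu>) *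
       complex_of_real \<bar>x\<bar> powr (a - 1) * w3 x (a - \<mu>) b c)"
    by (rule w6_integral)
next
  fix x :: real
  assume "Re (b - \<mu>) > 0" "Re (b - c - \<mu> + 1) > 0" "Re (a - b + 1) > 0"
    "a + (b - \<mu>) - c + 1 \<notin> \<int>\<^sub>\<le>\<^sub>0" "x \<in> {0<..<1} \<union> {1<..}"
  \<comment> \<open>The third identity is the first with a and b exchanged: this turns
    \<open>w4\<close> into \<open>w3\<close> and permutes the upper parameters of
    \<open>w5\<close>.\<close>
  then have "has_set_integral
      (\<lambda>y. complex_of_real (- y) powr (b - \<mu> - 1) * w4 y b a c * complex_of_real (x - y) powr (\<mu> - 1)) {..<0}
      (Gamma (b - \<mu>) * Gamma (b - c - \<mu> + 1) * Gamma (a - b + 1) * rGamma (b + a - c - \<mu> + 1) * rGamma (1 - \<mu>) *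
       complex_of_real x powr (b - 1) * w5 x (b - \<mu>) a c)"
    by (intro w4_integral) (auto simp: add.commute)
  then show "has_set_integral
      (\<lambda>y. complex_of_real (- y) powr (b - \<mu> - 1) * w3 y a b c * complex_of_real (x - y) powr (\<mu> - 1)) {..<0}
      (Gamma (b - \<mu>) * Gamma (b - c - \<mu> + 1) * Gamma (a - b + 1) * rGamma (a + b - c - \<mu> + 1) * rGamma (1 - \<mu>) *
       complex_of_real x powr (b - 1) * w5 x a (b - \<mu>) c)"
    by (simp only: w4_swap w5_swap[of x "b - \<mu>"] add.commute[of b a])
next
  fix x :: real
  assume "Re (b - c - \<mu> + 1) > 0" "Re (b - \<mu>) > 0" "Re (c - a - b + 1) > 0"
    "(b - \<mu>) - a + 1 \<notin> \<int>\<^sub>\<le>\<^sub>0" "x \<in> {..<0} \<union> {1<..}"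
  \<comment> \<open>The fourth identity arises likewise from the second: \<open>w6\<close> is
    symmetric in a and b, and \<open>w3\<close> becomes \<open>w4\<close>.\<close>
  then have "has_set_integral
      (\<lambda>y. complex_of_real y powr (b - \<mu> - 1) * w6 y b a c * complex_of_real \<bar>x - y\<bar> powr (\<mu> - 1)) {0<..<1}
      (Gamma (b - c - \<mu> + 1) * Gamma (b - \<mu>) * Gamma (c - b - a + 1) * rGamma (b - a - \<mu> + 1) * rGamma (1 - \<mu>) *
       complex_of_real \<bar>x\<bar> powr (b - 1) * w3 x (b - \<mu>) a c)"
    by (intro w6_integral) (auto simp: algebra_simps)
  then show "has_set_integral
      (\<lambda>y. complex_of_real y powr (b - \<mu> - 1) * w6 y a b c * complex_of_real \<bar>x - y\<bar> powr (\<mu> - 1)) {0<..<1}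
      (Gamma (b - c - \<mu> + 1) * Gamma (b - \<mu>) * Gamma (c - a - b + 1) * rGamma (b - a - \<mu> + 1) * rGamma (1 - \<mu>) *
       complex_of_real \<bar>x\<bar> powr (b - 1) * w4 x a (b - \<mu>) c)"
    by (simp only: w6_swap[of _ b a] w4_swap[symmetric] cancel_ab_semigroup_add_class.diff_right_commute[of c b a])
qed

end
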